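(* Work in the binary FFT model over the field $\mathbb{K}$. Let $P,Q\in\mathbb{K}[x]$ and $k\leqslant d$ be such that $\deg P=d$, $\deg Q=d-1$, and $B_1(P,Q),\dots,B_k(P,Q)$ are defined with $\deg B_i(P,Q)=1$ for all $1\leqslant i\leqslant k$. Then $B_{1;k+1}(P,Q)$ can be computed (by a single algorithm taking $P,Q,k$ as input) using $$\tfrac43\,\mathsf{M}(k)\log_2 k+O(\mathsf{M}(k))$$ operations in $\mathbb{K}$, where the implied constant does not depend on $P,Q,d,k$.
   Context: **Remainder sequences.** $\mathbb{K}$ is an (effective) field; $P\,\mathrm{quo}\,Q$ and $P\,\mathrm{rem}\,Q$ are quotient and remainder of Euclidean division in $\mathbb{K}[x]$. Let $P,Q\in\mathbb{K}[x]$ with $d:=\deg P>\deg Q$. Define $R_0:=P$, $R_1:=Q$, $R_{k+1}:=R_{k-1}\,\mathrm{rem}\,R_k$; the length $\ell$ is the smallest index with $R_\ell=0$. For $1\leqslant i<\ell$ let $B_i=B_i(P,Q):=\begin{pmatrix}0&1\\1&-R_{i-1}\,\mathrm{quo}\,R_i\end{pmatrix}$, regarded as a polynomial with coefficients in $\mathbb{K}^{2\times2}$ (so its degree is the maximum of the degrees of its entries). For $1\leqslant i\leqslant j\leqslant\ell$ let $B_{i;j}=B_{i;j}(P,Q):=B_{j-1}\cdots B_{i+1}B_i$ (with $B_{i;i}=\mathrm{Id}_2$). **Binary FFT model.** $2$ is invertible in $\mathbb{K}$, and for any polynomial $P$ occurring during computations, $\mathbb{K}$ contains a primitive $n$-th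 root of unity $\omega_n$ for some power of two $n>\deg P$, with $\omega_m=\omega_n^{n/m}$ whenever $m\mid n$. For a power of two $n$, $\mathrm{DFT}_n(P):=(P(\omega_n^0),P(\omega_n^1),\dots,P(\omega_n^{n-1}))$. $\mathsf{F}(n)$ is the maximum cost of computing $\mathrm{DFT}_n$ on $\mathbb{K}[x]_{<n}$ (polynomials of degree $<n$) or its inverse; $\mathsf{F}(n)/n$ and $\mathsf{F}(n)/(n\log n)$ are assumed non-decreasing (for $n\geqslant 1$, resp. $n\geqslant 2$). Complexity is the number of field operations in $\mathbb{K}$. $\mathsf{M}(d)$ is the cost of multiplying two polynomials in $\mathbb{K}[x]_{<d}$; using FFT multiplication, $\mathsf{M}(d)=6\,\mathsf{F}(d)+O(d)$ for $d$ a power of two, and any two polynomials with product of degree $<2d$ can be multiplied at cost $\mathsf{M}(d)+O(d)$. It is assumed that $\mathsf{M}(d)$, $\mathsf{M}(d)/d$ and $\mathsf{M}(d)/(d\log d)$ are non-decreasing (for $d\geqslant 0$, $d\geqslant 1$, $d\geqslant 2$ respectively). (One may take $\mathsf{M}(d)$ of the form $\alpha d\log_2 d+\beta d$ for constants $\alpha,\beta$.) *)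

theory Defs
  imports
    "HOL-Analysis.Analysis"
    "HOL-Computational_Algebra.Polynomial"
    "HOL-Library.Landau_Symbols"
begin

section \<open>Remainder sequences\<close>

fun rem_seq :: "'a::field poly \<Rightarrow> 'a poly \<Rightarrow> nat \<Rightarrow> 'a poly" where
  "rem_seq P Q 0 = P"
| "rem_seq P Q (Suc 0) = Q"
| "rem_seq P Q (Suc (Suc k)) = rem_seq P Q k mod rem_seq P Q (Suc k)"

text \<open>Because \<open>p mod 0 = p\<close>, the values of \<^const>\<open>rem_seq\<close> at and beyond
  \<open>rem_length P Q + 1\<close> are meaningless; the sequence is only used below this index.\<close>

definition rem_length :: "'a::field poly \<Rightarrow> 'a poly \<Rightarrow> nat" where
  "rem_length P Q = (LEAST l. rem_seq P Q l = 0)"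

text \<open>\<open>B_mat P Q i\<close> is the mathematical $B_i(P,Q)$ only for
  \<open>1 \<le> i < rem_length P Q\<close>.\<close>

definition B_mat :: "'a::field poly \<Rightarrow> 'a poly \<Rightarrow> nat \<Rightarrow> 'a poly ^ 2 ^ 2" where
  "B_mat P Q i =
     vector [vector [0, 1],
             vector [1, - (rem_seq P Q (i - 1) div rem_seq P Q i)]]"

text \<open>\<open>B_prod P Q i j = B_mat P Q (j - 1) ** \<dots> ** B_mat P Q i\<close>, the identity if \<open>j = i\<close>
  (and, as a default, if \<open>j < i\<close>).\<close>

primrec B_prod :: "'a::field poly \<Rightarrow> 'a poly \<Rightarrow> nat \<Rightarrow> nat \<Rightarrow> 'a poly ^ 2 ^ 2" where
  "B_prod P Q i 0 = mat 1"
| "B_prod P Q i (Suc j) = (if i \<le> j then B_mat P Q j ** B_prod P Q i j else mat 1)"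

text \<open>Degree of a matrix of polynomials, viewed as a polynomial with matrix coefficients.\<close>

definition mat_degree :: "'a::zero poly ^ 2 ^ 2 \<Rightarrow> nat" where
  "mat_degree A = Max {degree (A $ i $ j) | i j. True}"


section \<open>Algorithms over a field\<close>

text \<open>Algorithms are programs of a small first-order functional language. Its data are
  S-expressions over natural numbers (indices, sizes, control) and field elements. A program
  is a finite syntactic object without access to host-language functions on the field: field
  elements can only be moved around, combined by the four operations, and compared with
  zero. The cost of a run is the number of these operations and comparisons; everything
  else (data movement, index arithmetic, field constants) is free.\<close>

datatype 'a val = Num nat | Elem 'a | Nul | Cell "'a val" "'a val"

datatype nat_op = NAdd | NSub | NMul | NDiv | NMod

datatype field_op = FAdd | FSub | FMul | FDiv

text \<open>Every program maps one input value to one output value. \<open>Both\<close> runs two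
  programs on the same input and pairs the results. \<open>IfNum t p q\<close> runs the test \<open>t\<close> on the
  input and then \<open>q\<close> (if the result is \<open>Num 0\<close>) or \<open>p\<close> (if it is another number).
  \<open>Root\<close> turns \<open>n\<close> into the given root of unity of order \<open>n\<close>. \<open>Call p\<close> runs \<open>p\<close> as a
  separate recursive procedure, and \<open>Self\<close> is the recursive call of the innermost
  enclosing such procedure (of the whole program if there is none).\<close>

datatype 'a prog =
    Input
  | Seq "'a prog" "'a prog"
  | Both "'a prog" "'a prog"
  | Head
  | Tail
  | NulConst
  | IsNul
  | NatConst nat
  | NatOp nat_op
  | FieldConst 'a
  | FieldOp field_op
  | IsZero
  | Root
  | IfNum "'a prog" "'a prog" "'a prog"
  | Self
  | Call "'a prog"

fun apply_nat_op :: "nat_op \<Rightarrow> nat \<Rightarrow> nat \<Rightarrow> nat" where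
  "apply_nat_op NAdd m n = m + n"
| "apply_nat_op NSub m n = m - n"
| "apply_nat_op NMul m n = m * n"
| "apply_nat_op NDiv m n = m div n"
| "apply_nat_op NMod m n = m mod n"

fun apply_field_op :: "field_op \<Rightarrow> 'a::field \<Rightarrow> 'a \<Rightarrow> 'a" where
  "apply_field_op FAdd a b = a + b"
| "apply_field_op FSub a b = a - b"
| "apply_field_op FMul a b = a * b"
| "apply_field_op FDiv a b = a / b"

text \<open>\<open>eval N \<omega> s p v w c\<close>: within the procedure \<open>s\<close>, the program \<open>p\<close> terminates on
  input \<open>v\<close> with output \<open>w\<close> at cost \<open>c\<close>. Here \<open>N\<close> is the set of the orders of the
  available roots of unity \<open>\<omega> n\<close>. Ill-typed operations, division by zero, and requests for
  unavailable roots have no evaluation.\<close>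

inductive eval ::
  "nat set \<Rightarrow> (nat \<Rightarrow> 'a::field) \<Rightarrow> 'a prog \<Rightarrow> 'a prog \<Rightarrow> 'a val \<Rightarrow> 'a val \<Rightarrow> nat \<Rightarrow> bool"
  for N :: "nat set" and \<omega> :: "nat \<Rightarrow> 'a" where
  Input: "eval N \<omega> s Input v v 0"
| Seq: "eval N \<omega> s p u v c \<Longrightarrow> eval N \<omega> s q v w d \<Longrightarrow> eval N \<omega> s (Seq p q) u w (c + d)"
| Both: "eval N \<omega> s p u v c \<Longrightarrow> eval N \<omega> s q u w d \<Longrightarrow>
         eval N \<omega> s (Both p q) u (Cell v w) (c + d)"
| Head: "eval N \<omega> s Head (Cell v w) v 0"
| Tail: "eval N \<omega> s Tail (Cell v w) w 0"
| NulConst: "eval N \<omega> s NulConst v Nul 0"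
| IsNul: "eval N \<omega> s IsNul v (Num (if v = Nul then 1 else 0)) 0"
| NatConst: "eval N \<omega> s (NatConst n) v (Num n) 0"
| NatOp: "eval N \<omega> s (NatOp f) (Cell (Num m) (Num n)) (Num (apply_nat_op f m n)) 0"
| FieldConst: "eval N \<omega> s (FieldConst a) v (Elem a) 0"
| FieldOp: "f = FDiv \<longrightarrow> b \<noteq> 0 \<Longrightarrow>
            eval N \<omega> s (FieldOp f) (Cell (Elem a) (Elem b)) (Elem (apply_field_op f a b)) 1"
| IsZero: "eval N \<omega> s IsZero (Elem a) (Num (if a = 0 then 1 else 0)) 1"
| Root: "n \<in> N \<Longrightarrow> eval N \<omega> s Root (Num n) (Elem (\<omega> n)) 0"
| If_true: "eval N \<omega> s t v (Num n) c \<Longrightarrow> n \<noteq> 0 \<Longrightarrow> eval N \<omega> s p v w d \<Longrightarrow>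
            eval N \<omega> s (IfNum t p q) v w (c + d)"
| If_false: "eval N \<omega> s t v (Num 0) c \<Longrightarrow> eval N \<omega> s q v w d \<Longrightarrow>
             eval N \<omega> s (IfNum t p q) v w (c + d)"
| Self: "eval N \<omega> s s v w c \<Longrightarrow> eval N \<omega> s Self v w c"
| Call: "eval N \<omega> p p v w c \<Longrightarrow> eval N \<omega> s (Call p) v w c"

definition run ::
  "nat set \<Rightarrow> (nat \<Rightarrow> 'a::field) \<Rightarrow> 'a prog \<Rightarrow> 'a val \<Rightarrow> 'a val \<Rightarrow> nat \<Rightarrow> bool" where
  "run N \<omega> p = eval N \<omega> p p"

inductive_cases eval_elims:
  "eval N \<omega> s Input v w c"
  "eval N \<omega> s (Seq p q) v w c"
  "eval N \<omega> s (Both p q) v w c"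
  "eval N \<omega> s Head v w c"
  "eval N \<omega> s Tail v w c"
  "eval N \<omega> s NulConst v w c"
  "eval N \<omega> s IsNul v w c"
  "eval N \<omega> s (NatConst n) v w c"
  "eval N \<omega> s (NatOp f) v w c"
  "eval N \<omega> s (FieldConst a) v w c"
  "eval N \<omega> s (FieldOp g) v w c"
  "eval N \<omega> s IsZero v w c"
  "eval N \<omega> s Root v w c"
  "eval N \<omega> s (IfNum t p q) v w c"
  "eval N \<omega> s Self v w c"
  "eval N \<omega> s (Call p) v w c"

lemma eval_deterministic:
  "eval N \<omega> s p v w c \<Longrightarrow> eval N \<omega> s p v w' c' \<Longrightarrow> w' = w \<and> c' = c"
proof (induction arbitrary: w' c' rule: eval.induct)
  case (Seq s p u v c q w d)
  show ?case
    by (rule eval_elims(2)[OF Seq.prems]) (metis Seq.IH)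
next
  case (Both s p u v c q w d)
  show ?case
    by (rule eval_elims(3)[OF Both.prems]) (metis Both.IH)
next
  case (If_true s t v n c p w d q)
  show ?case
  proof (rule eval_elims(14)[OF If_true.prems])
    fix n' c1 d1
    assume "c' = c1 + d1" "eval N \<omega> s t v (Num n') c1" "eval N \<omega> s p v w' d1"
    then show ?thesis using If_true.IH by metis
  next
    fix c1 d1
    assume "eval N \<omega> s t v (Num 0) c1"
    then have "Num 0 = (Num n :: 'a val)" using If_true.IH(1) by metis
    then show ?thesis using If_true.hyps by simp
  qed
next
  case (If_false s t v c q w d p)
  show ?case
  proof (rule eval_elims(14)[OF If_false.prems])
    fix n' c1 d1
    assume n': "0 < n'" and "eval N \<omega> s t v (Num n') c1"
    then have "Num n' = (Num 0 :: 'a val)" using If_false.IH(1) by metis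
    then show ?thesis using n' by simp
  next
    fix c1 d1
    assume "c' = c1 + d1" "eval N \<omega> s t v (Num 0) c1" "eval N \<omega> s q v w' d1"
    then show ?thesis using If_false.IH by metis
  qed
next
  case (Self s v w c)
  show ?case by (rule eval_elims(15)[OF Self.prems]) (rule Self.IH)
next
  case (Call p v w c s)
  show ?case by (rule eval_elims(16)[OF Call.prems]) (rule Call.IH)
next
  case Input then show ?case by (blast elim: eval_elims(1))
next
  case Head then show ?case by (blast elim: eval_elims(4))
next
  case Tail then show ?case by (blast elim: eval_elims(5))
next
  case NulConst then show ?case by (blast elim: eval_elims(6))
next
  case IsNul then show ?case by (blast elim: eval_elims(7))
next
  case NatConst then show ?case by (blast elim: eval_elims(8))
next
  case NatOp then show ?case by (blast elim: eval_elims(9))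
next
  case FieldConst then show ?case by (blast elim: eval_elims(10))
next
  case FieldOp
  from FieldOp.prems show ?case by (rule eval_elims(11)) auto
next
  case IsZero
  from IsZero.prems show ?case by (rule eval_elims(12)) auto
next
  case Root
  from Root.prems show ?case by (blast elim: eval_elims(13))
qed

fun enc_list :: "'a list \<Rightarrow> 'a val" where
  "enc_list [] = Nul"
| "enc_list (x # xs) = Cell (Elem x) (enc_list xs)"

text \<open>Polynomials are stored as coefficient lists by increasing degree, without trailing
  zeros.\<close>

definition enc_poly :: "'a::zero poly \<Rightarrow> 'a val" where
  "enc_poly p = enc_list (coeffs p)"

definition enc_mat :: "'a::zero poly ^ 2 ^ 2 \<Rightarrow> 'a val" where
  "enc_mat A = Cell (Cell (enc_poly (A $ 1 $ 1)) (enc_poly (A $ 1 $ 2)))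
                    (Cell (enc_poly (A $ 2 $ 1)) (enc_poly (A $ 2 $ 2)))"


section \<open>The binary FFT model\<close>

definition primitive_root_of_unity :: "nat \<Rightarrow> 'a::field \<Rightarrow> bool" where
  "primitive_root_of_unity n z \<longleftrightarrow> n > 0 \<and> z ^ n = 1 \<and> (\<forall>m. 0 < m \<and> m < n \<longrightarrow> z ^ m \<noteq> 1)"

definition polys_below :: "nat \<Rightarrow> 'a::zero poly set" where
  "polys_below n = {p. p = 0 \<or> degree p < n}"

definition DFT :: "(nat \<Rightarrow> 'a::field) \<Rightarrow> nat \<Rightarrow> 'a poly \<Rightarrow> 'a list" where
  "DFT \<omega> n p = map (\<lambda>i. poly p (\<omega> n ^ i)) [0..<n]"

text \<open>\<open>N\<close> is the set of all powers of two \<open>n\<close> for which a root \<open>\<omega> n\<close> is at our disposal.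
  It need not be infinite, so finite fields are covered; whether \<open>N\<close> contains an \<open>n\<close> above
  the relevant degrees is asked for each given polynomial separately.\<close>

locale binary_FFT_model =
  fixes N :: "nat set" and \<omega> :: "nat \<Rightarrow> 'a::field" and F M :: "nat \<Rightarrow> real"
  assumes two_invertible: "(2::'a) \<noteq> 0"
    and N_powers_of_two: "n \<in> N \<Longrightarrow> \<exists>e. n = 2 ^ e"
    and N_roots: "n \<in> N \<Longrightarrow> primitive_root_of_unity n (\<omega> n)"
    and N_divisors: "n \<in> N \<Longrightarrow> m dvd n \<Longrightarrow> m \<in> N \<and> \<omega> m = \<omega> n ^ (n div m)"
    and DFT_cost: "\<exists>p. \<forall>n\<in>N. \<forall>A\<in>polys_below n. \<exists>c.
      run N \<omega> p (Cell (Num n) (enc_list (map (coeff A) [0..<n]))) (enc_list (DFT \<omega> n A)) c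
      \<and> real c \<le> F n"
    and inverse_DFT_cost: "\<exists>p. \<forall>n\<in>N. \<forall>A\<in>polys_below n. \<exists>c.
      run N \<omega> p (Cell (Num n) (enc_list (DFT \<omega> n A))) (enc_list (map (coeff A) [0..<n])) c
      \<and> real c \<le> F n"
    and F_mono1: "mono_on N (\<lambda>n. F n / real n)"
    and F_mono2: "mono_on (N \<inter> {2..}) (\<lambda>n. F n / (real n * log 2 (real n)))"
    and M_cost: "\<exists>p. \<forall>d. (\<exists>n\<in>N. 2 * d \<le> n) \<longrightarrow>
      (\<forall>A\<in>polys_below d. \<forall>B\<in>polys_below d. \<exists>c.
        run N \<omega> p (Cell (Num d) (Cell (enc_poly A) (enc_poly B))) (enc_poly (A * B)) c
        \<and> real c \<le> M d)"
    and M_cost_unbalanced: "\<exists>p C. \<forall>d. (\<exists>n\<in>N. 2 * d \<le> n) \<longrightarrow>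
      (\<forall>A B. A * B \<in> polys_below (2 * d) \<longrightarrow> (\<exists>c.
        run N \<omega> p (Cell (Num d) (Cell (enc_poly A) (enc_poly B))) (enc_poly (A * B)) c
        \<and> real c \<le> M d + C * real d))"
    and M_F: "\<exists>C. \<forall>d\<in>N. \<bar>M d - 6 * F d\<bar> \<le> C * real d"
    and M_pos: "d \<ge> 1 \<Longrightarrow> M d > 0"
    and M_mono: "mono M"
    and M_mono1: "mono_on {1..} (\<lambda>d. M d / real d)"
    and M_mono2: "mono_on {2..} (\<lambda>d. M d / (real d * log 2 (real d)))"

end

theory Submission
  imports Defs
begin

text \<open>The algorithm is the half-gcd recursion: for \<open>n = 2h\<close> a power of two, compute the matrix
  \<open>A\<close> of the first \<open>h\<close> steps, apply it to the pair of polynomials, compute the matrix \<open>B\<close>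
  of the remaining steps, and multiply. Together with its matrix, a call of size \<open>h\<close> returns
  the values of the entries at the roots of unity of order \<open>h\<close>. Hence one twisted DFT of order
  \<open>h\<close> per entry yields the values at all roots of order \<open>2h\<close>: 8 DFTs for \<open>A\<close> and \<open>B\<close>.
  The product \<open>BA\<close> costs 8 inverse DFTs. Applying \<open>A\<close> is a matter of middle products modulo
  \<open>x^(2h) - 1\<close>, with 8 DFTs and 8 inverse ones. This makes \<open>32 F(h)\<close>, that is, at most \<open>16 F(n)\<close>
  per node of size \<open>n\<close>. Up to \<open>O(n)\<close>, \<open>16 F(n)\<close> is \<open>8/3 M(n)\<close>, and as
  \<open>M(n) / (n log n)\<close> is non-decreasing, the sum over the levels is only half of
  \<open>8/3 M(k) log k\<close>.
  If \<open>k\<close> is not a power of two, the recursion decomposes it into binary; the additional nodes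
  have geometrically decreasing sizes and contribute only \<open>O(F(k))\<close>.\<close>

section \<open>Programs\<close>

fun vlist :: "'a val list \<Rightarrow> 'a val" where
  "vlist [] = Nul"
| "vlist (x # xs) = Cell x (vlist xs)"

definition tabl :: "nat \<Rightarrow> (nat \<Rightarrow> 'a val) \<Rightarrow> 'a val" where
  "tabl n f = vlist (map f [0..<n])"

abbreviation etabl :: "nat \<Rightarrow> (nat \<Rightarrow> 'a) \<Rightarrow> 'a val" where
  "etabl n f \<equiv> tabl n (\<lambda>i. Elem (f i))"

lemma enc_list_eq_vlist: "enc_list xs = vlist (map Elem xs)"
  by (induction xs) auto

lemma enc_list_map_upt: "enc_list (map f [0..<n]) = etabl n f"
  by (simp add: enc_list_eq_vlist tabl_def comp_def)

lemma tabl_cong: "(\<And>i. i < n \<Longrightarrow> f i = g i) \<Longrightarrow> tabl n f = tabl n g"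
  by (auto simp: tabl_def intro!: arg_cong[where f = vlist])

lemma tabl_2: "tabl 2 f = Cell (f 0) (Cell (f 1) Nul)"
  by (simp add: tabl_def numeral_2_eq_2)

section \<open>Evaluation with an upper bound on the cost\<close>

text \<open>The bound is real since the model bounds the transforms by the real-valued
  \<open>F\<close>. With an upper bound in place of the exact cost, the bounds for the parts of a
  program are simply added and later rounded up by \<open>evs_weaken\<close>.\<close>

definition evs ::
  "nat set \<Rightarrow> (nat \<Rightarrow> 'a::field) \<Rightarrow> 'a prog \<Rightarrow> 'a prog \<Rightarrow> 'a val \<Rightarrow> 'a val \<Rightarrow> real \<Rightarrow> bool" where
  "evs N \<omega> s p v w b \<longleftrightarrow> (\<exists>c. eval N \<omega> s p v w c \<and> real c \<le> b)"

lemma evs_weaken: "evs N \<omega> s p v w' b' \<Longrightarrow> w' = w \<Longrightarrow> b' \<le> b \<Longrightarrow> evs N \<omega> s p v w b"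
  unfolding evs_def by (blast intro: order_trans)

lemma evs_Seq: "evs N \<omega> s p u v a \<Longrightarrow> evs N \<omega> s q v w b \<Longrightarrow> evs N \<omega> s (Seq p q) u w (a + b)"
  unfolding evs_def by (metis Seq add_mono of_nat_add)

lemma evs_Both:
  "evs N \<omega> s p u v a \<Longrightarrow> evs N \<omega> s q u w b \<Longrightarrow> evs N \<omega> s (Both p q) u (Cell v w) (a + b)"
  unfolding evs_def by (metis Both add_mono of_nat_add)

lemma evs_free: "eval N \<omega> s p v w 0 \<Longrightarrow> evs N \<omega> s p v w 0"
  unfolding evs_def by force

lemma evs_Call: "evs N \<omega> p p v w b \<Longrightarrow> evs N \<omega> s (Call p) v w b"
  unfolding evs_def by (blast intro: Call)

lemma evs_Self: "evs N \<omega> s s v w b \<Longrightarrow> evs N \<omega> s Self v w b"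
  unfolding evs_def by (blast intro: Self)

lemma evs_If_true:
  "evs N \<omega> s t v (Num n) a \<Longrightarrow> n \<noteq> 0 \<Longrightarrow> evs N \<omega> s p v w b \<Longrightarrow>
    evs N \<omega> s (IfNum t p q) v w (a + b)"
  unfolding evs_def by (metis If_true add_mono of_nat_add)

lemma evs_If_false:
  "evs N \<omega> s t v (Num 0) a \<Longrightarrow> evs N \<omega> s q v w b \<Longrightarrow> evs N \<omega> s (IfNum t p q) v w (a + b)"
  unfolding evs_def by (metis If_false add_mono of_nat_add)

lemma evs_FieldOp:
  "f = FDiv \<longrightarrow> b \<noteq> 0 \<Longrightarrow>
    evs N \<omega> s (FieldOp f) (Cell (Elem a) (Elem b)) (Elem (apply_field_op f a b)) 1"
  unfolding evs_def using FieldOp[of f b N \<omega> s a] by force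

lemma evs_IsZero: "evs N \<omega> s IsZero (Elem a) (Num (if a = 0 then 1 else 0)) 1"
  unfolding evs_def using IsZero[of N \<omega> s a] by force

lemmas evs_prims = Input[THEN evs_free] Head[THEN evs_free] Tail[THEN evs_free]
  NulConst[THEN evs_free] IsNul[THEN evs_free] NatConst[THEN evs_free]
  NatOp[THEN evs_free] FieldConst[THEN evs_free]

section \<open>Programs on a stack\<close>

abbreviation stack :: "'a val list \<Rightarrow> 'a val" where
  "stack \<equiv> vlist"

text \<open>Programs on a stack: \<open>Var i\<close> reads the \<open>i\<close>-th entry, and \<open>Let_in p q\<close> pushes the value
  of \<open>p\<close> before it runs \<open>q\<close>.\<close>

primrec Var :: "nat \<Rightarrow> 'a prog" where
  "Var 0 = Head"
| "Var (Suc i) = Seq Tail (Var i)"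

definition Let_in :: "'a prog \<Rightarrow> 'a prog \<Rightarrow> 'a prog" where
  "Let_in p q = Seq (Both p Input) q"

fun args :: "'a prog list \<Rightarrow> 'a prog" where
  "args [] = NulConst"
| "args (p # ps) = Both p (args ps)"

definition nat_bin :: "nat_op \<Rightarrow> 'a prog \<Rightarrow> 'a prog \<Rightarrow> 'a prog" where
  "nat_bin f p q = Seq (Both p q) (NatOp f)"

definition field_bin :: "field_op \<Rightarrow> 'a prog \<Rightarrow> 'a prog \<Rightarrow> 'a prog" where
  "field_bin f p q = Seq (Both p q) (FieldOp f)"

abbreviation nadd (infixl "\<oplus>" 65) where "p \<oplus> q \<equiv> nat_bin NAdd p q"
abbreviation nsub (infixl "\<ominus>" 65) where "p \<ominus> q \<equiv> nat_bin NSub p q"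
abbreviation nmul (infixl "\<otimes>" 70) where "p \<otimes> q \<equiv> nat_bin NMul p q"
abbreviation ndiv where "ndiv p q \<equiv> nat_bin NDiv p q"
abbreviation nmod where "nmod p q \<equiv> nat_bin NMod p q"
abbreviation fadd (infixl "+\<^sub>f" 65) where "p +\<^sub>f q \<equiv> field_bin FAdd p q"
abbreviation fsub (infixl "-\<^sub>f" 65) where "p -\<^sub>f q \<equiv> field_bin FSub p q"
abbreviation fmul (infixl "*\<^sub>f" 70) where "p *\<^sub>f q \<equiv> field_bin FMul p q"
abbreviation fdiv (infixl "'/\<^sub>f" 70) where "p /\<^sub>f q \<equiv> field_bin FDiv p q"

lemma evs_Var_0: "evs N \<omega> s (Var 0) (stack (v # vs)) v 0"
  by (simp add: evs_prims)

lemma evs_Var_Suc: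
  "evs N \<omega> s (Var i) (stack vs) w b \<Longrightarrow> evs N \<omega> s (Var (Suc i)) (stack (v # vs)) w b"
  using evs_Seq[OF evs_prims(3)] by fastforce

lemma evs_Let:
  "evs N \<omega> s p (stack vs) v a \<Longrightarrow> evs N \<omega> s q (stack (v # vs)) w b \<Longrightarrow>
    evs N \<omega> s (Let_in p q) (stack vs) w (a + b)"
  unfolding Let_in_def using evs_Seq[OF evs_Both[OF _ evs_prims(1)]] by fastforce

lemma evs_args_Nil: "evs N \<omega> s (args []) v (stack []) 0"
  by (simp add: evs_prims)

lemma evs_args_Cons:
  "evs N \<omega> s p v x a \<Longrightarrow> evs N \<omega> s (args ps) v (stack xs) b \<Longrightarrow>
    evs N \<omega> s (args (p # ps)) v (stack (x # xs)) (a + b)"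
  by (simp add: evs_Both)

lemma evs_nat_bin:
  "evs N \<omega> s p v (Num m) a \<Longrightarrow> evs N \<omega> s q v (Num n) b \<Longrightarrow>
    evs N \<omega> s (nat_bin f p q) v (Num (apply_nat_op f m n)) (a + b)"
  unfolding nat_bin_def using evs_Seq[OF evs_Both evs_prims(7)] by fastforce

lemma evs_fadd:
  "evs N \<omega> s p v (Elem x) a \<Longrightarrow> evs N \<omega> s q v (Elem y) b \<Longrightarrow>
    evs N \<omega> s (p +\<^sub>f q) v (Elem (x + y)) (a + b + 1)"
  unfolding field_bin_def using evs_Seq[OF evs_Both evs_FieldOp[of FAdd]] by fastforce

lemma evs_fsub:
  "evs N \<omega> s p v (Elem x) a \<Longrightarrow> evs N \<omega> s q v (Elem y) b \<Longrightarrow>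
    evs N \<omega> s (p -\<^sub>f q) v (Elem (x - y)) (a + b + 1)"
  unfolding field_bin_def using evs_Seq[OF evs_Both evs_FieldOp[of FSub]] by fastforce

lemma evs_fmul:
  "evs N \<omega> s p v (Elem x) a \<Longrightarrow> evs N \<omega> s q v (Elem y) b \<Longrightarrow>
    evs N \<omega> s (p *\<^sub>f q) v (Elem (x * y)) (a + b + 1)"
  unfolding field_bin_def using evs_Seq[OF evs_Both evs_FieldOp[of FMul]] by fastforce

lemma evs_fdiv:
  "evs N \<omega> s p v (Elem x) a \<Longrightarrow> evs N \<omega> s q v (Elem y) b \<Longrightarrow> y \<noteq> 0 \<Longrightarrow>
    evs N \<omega> s (p /\<^sub>f q) v (Elem (x / y)) (a + b + 1)"
  unfolding field_bin_def using evs_Seq[OF evs_Both evs_FieldOp[of FDiv]] by fastforce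

section \<open>Loops and tables\<close>

text \<open>The index runs downwards from \<open>n - 1\<close> to 0. \<open>Call\<close> makes the
  loop a procedure of its own, so \<open>Self\<close> inside \<open>b\<close> would mean the loop;
  hence \<open>evs_For\<close> asks for the behaviour of \<open>b\<close> within every procedure
  \<open>s\<close>.\<close>

definition For :: "'a prog \<Rightarrow> 'a prog" where
  "For b = Call (IfNum Head
     (Seq (Both (Head \<ominus> NatConst 1) (Seq (Both (Head \<ominus> NatConst 1) Tail) b)) Self) Tail)"

lemma evs_For:
  assumes "\<And>i s. i < n \<Longrightarrow> evs N \<omega> s b (Cell (Num i) (st (Suc i))) (st i) c"
  shows "evs N \<omega> s (For b) (Cell (Num n) (st n)) (st 0) (real n * c)"
  unfolding For_def
proof (rule evs_Call)
  let ?p = "IfNum Head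
     (Seq (Both (Head \<ominus> NatConst 1) (Seq (Both (Head \<ominus> NatConst 1) Tail) b)) Self) Tail"
  show "evs N \<omega> ?p ?p (Cell (Num n) (st n)) (st 0) (real n * c)"
    using assms
  proof (induction n)
    case 0
    show ?case
      by (rule evs_weaken, rule evs_If_false, (rule evs_prims)+) simp_all
  next
    case (Suc n)
    have dec: "evs N \<omega> ?p (Head \<ominus> NatConst 1) (Cell (Num (Suc n)) (st (Suc n))) (Num n) 0"
      by (rule evs_weaken, rule evs_nat_bin, (rule evs_prims)+) simp_all
    have "evs N \<omega> ?p ?p (Cell (Num (Suc n)) (st (Suc n))) (st 0)
        (0 + (0 + (0 + 0 + c) + real n * c))"
      by (rule evs_If_true[OF evs_prims(2)], simp, rule evs_Seq, rule evs_Both[OF dec],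
          rule evs_Seq, rule evs_Both[OF dec evs_prims(3)], rule Suc.prems, simp,
          rule evs_Self, rule Suc.IH, rule Suc.prems, simp)
    then show ?case by (rule evs_weaken) (auto simp: algebra_simps)
  qed
qed

text \<open>As the loop counts down, prepending the values yields the table in increasing order. The
  stack is carried along in the loop state, so that \<open>b\<close> sees it below the
  index.\<close>

definition tab :: "'a prog \<Rightarrow> 'a prog \<Rightarrow> 'a prog" where
  "tab n b = Seq (Both n (Both Input NulConst))
     (Seq (For (Both (Seq Tail Head)
        (Both (Seq (Both Head (Seq Tail Head)) b) (Seq Tail Tail)))) Tail)"

lemma evs_tab:
  assumes n: "evs N \<omega> s p (stack vs) (Num n) a"
    and b: "\<And>i s. i < n \<Longrightarrow> evs N \<omega> s b (stack (Num i # vs)) (f i) c"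
  shows "evs N \<omega> s (tab p b) (stack vs) (tabl n f) (a + real n * c)"
proof -
  define st where "st i = Cell (stack vs) (vlist (map f [i..<n]))" for i
  have "evs N \<omega> s' (Both (Seq Tail Head) (Both (Seq (Both Head (Seq Tail Head)) b) (Seq Tail Tail)))
      (Cell (Num i) (st (Suc i))) (st i) (0 + 0 + (0 + (0 + 0) + c + (0 + 0)))"
    if i: "i < n" for i s'
  proof -
    have "st i = Cell (stack vs) (Cell (f i) (vlist (map f [Suc i..<n])))"
      using i by (simp add: st_def upt_conv_Cons)
    moreover have "evs N \<omega> s' b (Cell (Num i) (stack vs)) (f i) c"
      using b[OF i] by simp
    ultimately show ?thesis
      by (simp only: st_def) (rule evs_Both evs_Seq evs_prims | assumption)+
  qed
  then have "evs N \<omega> s (For (Both (Seq Tail Head)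
        (Both (Seq (Both Head (Seq Tail Head)) b) (Seq Tail Tail))))
      (Cell (Num n) (st n)) (st 0) (real n * c)"
    using evs_For[of n N \<omega> _ st c] by simp
  moreover have "st n = Cell (stack vs) Nul" "st 0 = Cell (stack vs) (tabl n f)"
    by (simp_all add: st_def tabl_def)
  ultimately show ?thesis
    using evs_Seq[OF evs_Both[OF n evs_Both[OF evs_prims(1,4)]] evs_Seq[OF _ evs_prims(3)]]
    unfolding tab_def by fastforce
qed

definition fsum :: "'a::zero prog \<Rightarrow> 'a prog \<Rightarrow> 'a prog" where
  "fsum n b = Seq (Both n (Both Input (FieldConst 0)))
     (Seq (For (Both (Seq Tail Head)
        (Seq Tail Tail +\<^sub>f Seq (Both Head (Seq Tail Head)) b))) Tail)"

lemma evs_fsum: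
  assumes n: "evs N \<omega> s p (stack vs) (Num n) a"
    and b: "\<And>i s. i < n \<Longrightarrow> evs N \<omega> s b (stack (Num i # vs)) (Elem (f i)) c"
  shows "evs N \<omega> s (fsum p b) (stack vs) (Elem (\<Sum>i<n. f i)) (a + real n * (c + 1))"
proof -
  define st where "st i = Cell (stack vs) (Elem (\<Sum>j=i..<n. f j))" for i
  have "evs N \<omega> s' (Both (Seq Tail Head) (Seq Tail Tail +\<^sub>f Seq (Both Head (Seq Tail Head)) b))
      (Cell (Num i) (st (Suc i))) (st i) (0 + 0 + ((0 + 0) + (0 + (0 + 0) + c) + 1))"
    if i: "i < n" for i s'
  proof -
    have "st i = Cell (stack vs) (Elem ((\<Sum>j=Suc i..<n. f j) + f i))"
      using i by (simp add: st_def sum.atLeast_Suc_lessThan add.commute)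
    moreover have "evs N \<omega> s' b (Cell (Num i) (stack vs)) (Elem (f i)) c"
      using b[OF i] by simp
    ultimately show ?thesis
      by (simp only: st_def) (rule evs_Both evs_Seq evs_fadd evs_prims | assumption)+
  qed
  then have "evs N \<omega> s (For (Both (Seq Tail Head)
        (Seq Tail Tail +\<^sub>f Seq (Both Head (Seq Tail Head)) b)))
      (Cell (Num n) (st n)) (st 0) (real n * (c + 1))"
    using evs_For[of n N \<omega> _ st "c + 1"] by simp
  moreover have "st n = Cell (stack vs) (Elem 0)" "st 0 = Cell (stack vs) (Elem (\<Sum>i<n. f i))"
    by (simp_all add: st_def lessThan_atLeast0)
  ultimately show ?thesis
    using evs_Seq[OF evs_Both[OF n evs_Both[OF evs_prims(1,8)]] evs_Seq[OF _ evs_prims(3)]]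
    unfolding fsum_def by fastforce
qed

text \<open>Each new power is the current head times \<open>g\<close> and is prepended, at one
  multiplication each; this is why the exponents decrease along the table.\<close>

definition powers :: "'a::one prog \<Rightarrow> 'a prog \<Rightarrow> 'a prog" where
  "powers n g = Seq (Both n (Both g (Both (FieldConst 1) NulConst)))
     (Seq (For (Both (Seq Tail Head)
        (Both (Seq Tail (Seq Tail Head) *\<^sub>f Seq Tail Head) (Seq Tail Tail)))) Tail)"

lemma evs_powers:
  assumes n: "evs N \<omega> s p v (Num n) a" and g: "evs N \<omega> s q v (Elem g) b"
  shows "evs N \<omega> s (powers p q) v (etabl (Suc n) (\<lambda>i. g ^ (n - i))) (a + b + real n)"
proof -
  define st where "st i = Cell (Elem g) (enc_list (rev (map ((^) g) [0..<Suc (n - i)])))" for i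
  have "evs N \<omega> s' (Both (Seq Tail Head)
        (Both (Seq Tail (Seq Tail Head) *\<^sub>f Seq Tail Head) (Seq Tail Tail)))
      (Cell (Num i) (st (Suc i))) (st i) (0 + 0 + ((0 + (0 + 0)) + (0 + 0) + 1 + (0 + 0)))"
    if i: "i < n" for i s'
  proof -
    have m: "n - i = Suc (n - Suc i)" using i by simp
    have st: "st i = Cell (Elem g) (Cell (Elem (g ^ (n - Suc i) * g))
      (Cell (Elem (g ^ (n - Suc i))) (enc_list (rev (map ((^) g) [0..<n - Suc i])))))"
      unfolding st_def m by (simp add: mult.commute)
    have st': "st (Suc i) = Cell (Elem g) (Cell (Elem (g ^ (n - Suc i)))
      (enc_list (rev (map ((^) g) [0..<n - Suc i]))))"
      unfolding st_def by simp
    show ?thesis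
      unfolding st st' by (rule evs_Both evs_Seq evs_fmul evs_prims)+
  qed
  then have *: "evs N \<omega> s (For (Both (Seq Tail Head)
        (Both (Seq Tail (Seq Tail Head) *\<^sub>f Seq Tail Head) (Seq Tail Tail))))
      (Cell (Num n) (st n)) (st 0) (real n * 1)"
    using evs_For[of n N \<omega> _ st 1] by simp
  have st0: "st 0 = Cell (Elem g) (etabl (Suc n) (\<lambda>i. g ^ (n - i)))"
  proof -
    have "rev (map ((^) g) [0..<Suc n]) = map (\<lambda>i. g ^ (n - i)) [0..<Suc n]"
      by (rule nth_equalityI) (auto simp: rev_nth simp del: upt_Suc)
    then show ?thesis
      unfolding st_def enc_list_map_upt[symmetric] by simp
  qed
  have "st n = Cell (Elem g) (Cell (Elem 1) Nul)"
    by (simp add: st_def)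
  with * st0 have "evs N \<omega> s (powers p q) v (etabl (Suc n) (\<lambda>i. g ^ (n - i)))
      (a + (b + (0 + 0)) + (real n * 1 + 0))"
    unfolding powers_def
    using evs_Seq[OF evs_Both[OF n evs_Both[OF g evs_Both[OF evs_prims(8,4)]]]
        evs_Seq[OF _ evs_prims(3)]] by metis
  then show ?thesis by (simp add: algebra_simps)
qed

text \<open>The loop drops \<open>j\<close> entries, the tail of an empty list being taken as empty;
  reading past the end therefore gives the field element 0.\<close>

definition get :: "'a::zero prog \<Rightarrow> 'a prog \<Rightarrow> 'a prog" where
  "get p i = Seq (Both i p)
     (Seq (For (Seq Tail (IfNum IsNul NulConst Tail))) (IfNum IsNul (FieldConst 0) Head))"

lemma evs_get_gen:
  assumes p: "evs N \<omega> s p v (vlist xs) a" and i: "evs N \<omega> s i v (Num j) b"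
  shows "evs N \<omega> s (get p i) v (if j < length xs then xs ! j else Elem 0) (a + b)"
proof -
  define st where "st i = vlist (drop (j - i) xs)" for i
  have "evs N \<omega> s' (Seq Tail (IfNum IsNul NulConst Tail))
      (Cell (Num i) (st (Suc i))) (st i) (0 + (0 + 0))"
    if i: "i < j" for i s'
  proof -
    define ys where "ys = drop (j - Suc i) xs"
    have "drop (j - i) xs = drop 1 ys"
      using i by (simp add: ys_def Suc_diff_Suc)
    moreover have "evs N \<omega> s' (Seq Tail (IfNum IsNul NulConst Tail))
      (Cell (Num i) (vlist ys)) (vlist (drop 1 ys)) (0 + (0 + 0))"
    proof (cases ys)
      case Nil
      show ?thesis unfolding Nil
        by simp (rule evs_weaken, rule evs_Seq, rule evs_prims, rule evs_If_true,
            rule evs_prims, simp, rule evs_prims, simp_all)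
    next
      case (Cons y ys')
      show ?thesis unfolding Cons
        apply simp
        apply (rule evs_weaken)
        apply (rule evs_Seq)
        apply (rule evs_prims)
        apply (rule evs_If_false)
        using evs_prims(5)[of N \<omega> s' "Cell y (vlist ys')"] apply simp
        apply (rule evs_prims)
        by simp_all
    qed
    ultimately show ?thesis by (simp add: st_def ys_def)
  qed
  then have *: "evs N \<omega> s (For (Seq Tail (IfNum IsNul NulConst Tail)))
      (Cell (Num j) (st j)) (st 0) (real j * 0)"
    using evs_For[of j N \<omega> _ st 0] by simp
  have **: "evs N \<omega> s (IfNum IsNul (FieldConst 0) Head) (st 0)
      (if j < length xs then xs ! j else Elem 0) (0 + 0)"
  proof (cases "j < length xs")
    case True
    then have "st 0 = Cell (xs ! j) (vlist (drop (Suc j) xs))"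
      by (simp add: st_def Cons_nth_drop_Suc[symmetric])
    then show ?thesis using True evs_prims(5)[of N \<omega> s "st 0"]
      by simp (rule evs_weaken, rule evs_If_false, simp, rule evs_prims, simp_all)
  next
    case False
    then have "st 0 = Nul" by (simp add: st_def)
    then show ?thesis using False evs_prims(5)[of N \<omega> s "st 0"]
      by simp (rule evs_weaken, rule evs_If_true, simp, simp, rule evs_prims, simp_all)
  qed
  have "st j = vlist xs" by (simp add: st_def)
  then have "evs N \<omega> s (get p i) v (if j < length xs then xs ! j else Elem 0)
      (b + a + (real j * 0 + (0 + 0)))"
    unfolding get_def using evs_Seq[OF evs_Both[OF i p] evs_Seq[OF _ **]] * by metis
  then show ?thesis by (simp add: algebra_simps)
qed

lemma evs_get:
  assumes "evs N \<omega> s p v (tabl n f) a" "evs N \<omega> s i v (Num j) b" "f j = w" "j < n"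
  shows "evs N \<omega> s (get p i) v w (a + b)"
  using evs_get_gen[OF assms(1,2)[unfolded tabl_def]] assms(3,4) by simp

text \<open>A second name makes the choice visible in the syntax between \<open>evs_get\<close>,
  which needs an index in range, and \<open>evs_getc\<close>, which pads with zeros.
  \<open>If_field\<close> likewise sets conditionals with field values apart from
  \<open>IfNum\<close>.\<close>

definition getc :: "'a::zero prog \<Rightarrow> 'a prog \<Rightarrow> 'a prog" where
  "getc = get"

lemma evs_getc:
  assumes "evs N \<omega> s p v (etabl n f) a" "evs N \<omega> s i v (Num j) b"
  shows "evs N \<omega> s (getc p i) v (Elem (if j < n then f j else 0)) (a + b)"
  using evs_get_gen[OF assms(1)[unfolded tabl_def] assms(2)]
  by (simp add: if_distrib getc_def cong: if_cong)

definition If_field :: "'a prog \<Rightarrow> 'a prog \<Rightarrow> 'a prog \<Rightarrow> 'a prog" where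
  "If_field = IfNum"

lemma evs_If_field:
  assumes t: "evs N \<omega> s t v (Num n) a"
    and p: "n \<noteq> 0 \<Longrightarrow> evs N \<omega> s p v (Elem x) b" and q: "n = 0 \<Longrightarrow> evs N \<omega> s q v (Elem y) b'"
  shows "evs N \<omega> s (If_field t p q) v (Elem (if n \<noteq> 0 then x else y)) (a + max b b')"
proof (cases "n = 0")
  case True
  then show ?thesis
    unfolding If_field_def
    by (intro evs_weaken[OF evs_If_false[OF _ q]]) (use t in auto)
next
  case False
  then show ?thesis
    unfolding If_field_def
    by (intro evs_weaken[OF evs_If_true[OF t False p]]) auto
qed

abbreviation V0 :: "'a prog" where "V0 \<equiv> Var 0"
abbreviation V1 :: "'a prog" where "V1 \<equiv> Var (Suc 0)"
abbreviation V2 :: "'a prog" where "V2 \<equiv> Var (Suc (Suc 0))"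
abbreviation V3 :: "'a prog" where "V3 \<equiv> Var (Suc (Suc (Suc 0)))"
abbreviation V4 :: "'a prog" where "V4 \<equiv> Var (Suc (Suc (Suc (Suc 0))))"
abbreviation V5 :: "'a prog" where "V5 \<equiv> Var (Suc (Suc (Suc (Suc (Suc 0)))))"
abbreviation V6 :: "'a prog" where "V6 \<equiv> Var (Suc (Suc (Suc (Suc (Suc (Suc 0))))))"
abbreviation V7 :: "'a prog" where "V7 \<equiv> Var (Suc (Suc (Suc (Suc (Suc (Suc (Suc 0)))))))"
abbreviation V8 :: "'a prog" where "V8 \<equiv> Var (Suc (Suc (Suc (Suc (Suc (Suc (Suc (Suc 0))))))))"
abbreviation V9 :: "'a prog" where "V9 \<equiv> Var (Suc (Suc (Suc (Suc (Suc (Suc (Suc (Suc (Suc 0)))))))))"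
abbreviation V10 :: "'a prog" where "V10 \<equiv> Var (Suc (Suc (Suc (Suc (Suc (Suc (Suc (Suc (Suc (Suc 0))))))))))"
abbreviation V11 :: "'a prog" where "V11 \<equiv> Var (Suc (Suc (Suc (Suc (Suc (Suc (Suc (Suc (Suc (Suc (Suc 0)))))))))))"

section \<open>Products of quotient matrices\<close>

definition act :: "'a::field poly \<Rightarrow> (nat \<Rightarrow> 'a) \<Rightarrow> nat \<Rightarrow> 'a" where
  "act A f j = (\<Sum>i\<le>degree A. coeff A i * f (i + j))"

lemma act_bound:
  assumes "degree A \<le> n"
  shows "act A f j = (\<Sum>i\<le>n. coeff A i * f (i + j))"
  unfolding act_def
  by (rule sum.mono_neutral_left) (use assms in \<open>auto simp: coeff_eq_0\<close>)

lemma act_add: "act (A + B) f j = act A f j + act B f j"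
proof -
  let ?n = "max (degree A) (degree B)"
  show ?thesis
    using degree_add_le_max[of A B]
    by (simp add: act_bound[of _ ?n] sum.distrib ring_distribs)
qed

lemma act_add_fun: "act A (\<lambda>j. f j + g j) j = act A f j + act A g j"
  by (simp add: act_def sum.distrib ring_distribs)

lemma act_0 [simp]: "act 0 f j = 0" and act_1 [simp]: "act 1 f j = f j"
  by (simp_all add: act_def)

lemma act_smult: "act (smult a A) f j = a * act A f j"
  by (simp add: act_bound[of _ "degree A"] degree_smult_le sum_distrib_left mult.assoc)

lemma act_pCons: "act (pCons a A) f j = a * f j + act A f (Suc j)"
proof -
  have "act (pCons a A) f j = (\<Sum>i\<le>Suc (degree A). coeff (pCons a A) i * f (i + j))"
    by (rule act_bound) (simp add: degree_pCons_le)
  then show ?thesis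
    unfolding sum.atMost_Suc_shift by (simp add: act_def)
qed

text \<open>Associativity of the module action; the induction works because \<open>act_pCons\<close>
  splits off a single shift. It turns matrix products into composed actions in
  \<open>mact_mult\<close>.\<close>

lemma act_mult: "act (A * B) f j = act A (act B f) j"
proof (induction A arbitrary: j)
  case (pCons a A)
  show ?case
    by (simp add: act_add act_smult act_pCons pCons.IH)
qed simp

lemma act_shift: "act A (\<lambda>j. f (j + m)) j = act A f (j + m)"
  by (simp add: act_def add.assoc)

text \<open>Rows and columns are numbered 0 and 1, as in the tables of the programs. Every nonzero
  index means the second one, so degree bounds can be stated without restricting the
  indices.\<close>

definition entry :: "'a ^ 2 ^ 2 \<Rightarrow> nat \<Rightarrow> nat \<Rightarrow> 'a" where
  "entry A r c = A $ (if r = 0 then 1 else 2) $ (if c = 0 then 1 else 2)"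

lemma entry_mult:
  "entry (A ** B) r c = entry A r 0 * entry B 0 c + entry A r 1 * entry B 1 c"
  by (simp add: entry_def matrix_matrix_mult_def sum_2)

lemma entry_one: "r < 2 \<Longrightarrow> c < 2 \<Longrightarrow> entry (mat 1) r c = (if r = c then 1 else 0)"
  by (auto simp: entry_def mat_def less_2_cases_iff)

text \<open>A polynomial \<open>A\<close> of degree at most \<open>d\<close> is represented by its coefficients in
  decreasing order \<open>\<lambda>j. coeff A (d - j)\<close>, and a pair of polynomials by
  \<open>v :: nat \<Rightarrow> nat \<Rightarrow> 'a\<close>, of which only \<open>v 0\<close> and \<open>v 1\<close> matter. In this representation,
  multiplication by \<open>x\<close> is a left shift, and \<^term>\<open>act\<close> is the resulting module structure.\<close>

definition mact :: "'a::field poly ^ 2 ^ 2 \<Rightarrow> (nat \<Rightarrow> nat \<Rightarrow> 'a) \<Rightarrow> nat \<Rightarrow> nat \<Rightarrow> 'a" where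
  "mact A v r j = act (entry A r 0) (v 0) j + act (entry A r 1) (v 1) j"

section \<open>Quotient matrices from leading coefficients\<close>

text \<open>For polynomials of degrees \<open>d\<close> and \<open>d - 1\<close> the quotient is
  linear, and comparing the two leading coefficients determines it. The leading coefficient of the
  divisor is \<open>v 1 1\<close>, as both sequences start at degree \<open>d\<close>.\<close>

definition lead_quo :: "(nat \<Rightarrow> nat \<Rightarrow> 'a::field) \<Rightarrow> 'a poly" where
  "lead_quo v = (let a = v 0 0 / v 1 1 in [:(v 0 1 - a * v 1 2) / v 1 1, a:])"

definition step_mat :: "(nat \<Rightarrow> nat \<Rightarrow> 'a::field) \<Rightarrow> 'a poly ^ 2 ^ 2" where
  "step_mat v = vector [vector [0, 1], vector [1, - lead_quo v]]"

text \<open>A division step lowers the degree bound by one; the shift puts the leading coefficients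
  back at the indices 0 and 1.\<close>

definition next_pair :: "(nat \<Rightarrow> nat \<Rightarrow> 'a::field) \<Rightarrow> nat \<Rightarrow> nat \<Rightarrow> 'a" where
  "next_pair v r j = mact (step_mat v) v r (Suc j)"

fun quo_mat :: "nat \<Rightarrow> (nat \<Rightarrow> nat \<Rightarrow> 'a::field) \<Rightarrow> 'a poly ^ 2 ^ 2" where
  "quo_mat 0 v = mat 1"
| "quo_mat (Suc k) v = quo_mat k (next_pair v) ** step_mat v"

fun regular :: "nat \<Rightarrow> (nat \<Rightarrow> nat \<Rightarrow> 'a::field) \<Rightarrow> bool" where
  "regular 0 v = True"
| "regular (Suc k) v \<longleftrightarrow> v 1 1 \<noteq> 0 \<and> regular k (next_pair v)"

lemma entry_step_mat:
  "entry (step_mat v) r c = (if r = 0 then (if c = 0 then 0 else 1) else (if c = 0 then 1 else - lead_quo v))"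
  by (simp add: entry_def step_mat_def vector_2)

lemma act_neg: "act (- A) f j = - act A f j"
  using act_smult[of "-1" A f j] by simp

lemma next_pair_0: "next_pair v 0 j = v 1 (Suc j)"
  by (simp add: next_pair_def mact_def entry_step_mat)

lemma next_pair_1:
  "next_pair v (Suc r) j = v 0 (Suc j) -
    (coeff (lead_quo v) 0 * v 1 (Suc j) + coeff (lead_quo v) 1 * v 1 (Suc (Suc j)))"
  by (simp add: next_pair_def mact_def entry_step_mat act_neg lead_quo_def Let_def act_pCons)

lemma lead_quo_cong:
  assumes "\<And>c j. c < 2 \<Longrightarrow> j \<le> 2 \<Longrightarrow> v c j = w c j"
  shows "lead_quo v = lead_quo w"
  using assms by (simp add: lead_quo_def Let_def)

text \<open>A step reads indices up to 2 for its quotient and up to \<open>j + 2\<close> for the new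
  index \<open>j\<close>, so \<open>k\<close> steps see only the first \<open>2 * k + 1\<close>
  terms. This permits recursive calls on truncated data.\<close>

lemma quo_mat_cong:
  assumes "\<And>c j. c < 2 \<Longrightarrow> j \<le> 2 * k \<Longrightarrow> v c j = w c j"
  shows "quo_mat k v = quo_mat k w \<and> regular k v = regular k w"
  using assms
proof (induction k arbitrary: v w)
  case (Suc k)
  have q: "lead_quo v = lead_quo w"
    by (rule lead_quo_cong) (use Suc.prems in auto)
  have "quo_mat k (next_pair v) = quo_mat k (next_pair w) \<and>
      regular k (next_pair v) = regular k (next_pair w)"
    by (rule Suc.IH) (use Suc.prems q in \<open>auto simp: less_2_cases_iff next_pair_0 next_pair_1\<close>)
  moreover have "step_mat v = step_mat w"
    using q by (simp add: step_mat_def)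
  moreover have "v 1 1 = w 1 1" using Suc.prems[of 1 1] by simp
  ultimately show ?case by simp
qed simp

lemma quo_mat_add:
  "quo_mat (m + k) v = quo_mat k ((next_pair ^^ m) v) ** quo_mat m v"
  by (induction m arbitrary: v) (simp_all add: matrix_mul_assoc funpow_swap1)

lemma regular_add:
  "regular (m + k) v \<longleftrightarrow> regular m v \<and> regular k ((next_pair ^^ m) v)"
  by (induction m arbitrary: v) (simp_all add: funpow_swap1)

lemma mact_mult: "mact (A ** B) v = mact A (mact B v)"
proof (intro ext)
  fix r j
  have "act (entry A r m) (mact B v m) j = 
    act (entry A r m) (\<lambda>j. act (entry B m 0) (v 0) j + act (entry B m 1) (v 1) j) j" for m
    by (rule arg_cong[where f = "\<lambda>f. act _ f j"]) (simp add: mact_def fun_eq_iff)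
  then show "mact (A ** B) v r j = mact A (mact B v) r j"
    unfolding mact_def[of "A ** B"] mact_def[of A]
    by (simp add: entry_mult act_add act_mult act_add_fun)
qed

lemma mact_shift: "mact A (\<lambda>c j. v c (j + m)) r j = mact A v r (j + m)"
  by (simp add: mact_def act_shift)

text \<open>\<open>mact\<close> commutes with shifts, so the shifts of the single steps can be
  collected at the end: one application of a matrix replaces \<open>m\<close> divisions.\<close>

lemma funpow_next_pair: "r < 2 \<Longrightarrow> (next_pair ^^ m) v r j = mact (quo_mat m v) v r (j + m)"
proof (induction m arbitrary: v j)
  case 0
  then show ?case by (auto simp: mact_def entry_one less_2_cases_iff)
next
  case (Suc m)
  have v: "next_pair v = (\<lambda>c j. mact (step_mat v) v c (j + 1))"
    by (simp add: next_pair_def fun_eq_iff)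
  have "(next_pair ^^ Suc m) v r j = mact (quo_mat m (next_pair v)) (next_pair v) r (j + m)"
    using Suc by (simp add: funpow_swap1)
  also have "\<dots> = mact (quo_mat m (next_pair v)) (mact (step_mat v) v) r (j + m + 1)"
    by (subst (2) v) (rule mact_shift)
  finally show ?case
    unfolding quo_mat.simps mact_mult by simp
qed

lemma degree_quo_mat: "degree (entry (quo_mat k v) r c) \<le> k"
proof (induction k arbitrary: v r c)
  case 0
  then show ?case by (simp add: entry_def mat_def)
next
  case (Suc k)
  have 1: "degree (lead_quo v) \<le> 1"
    by (simp add: lead_quo_def Let_def)
  have "degree (entry (quo_mat k (next_pair v)) r m * entry (step_mat v) m c) \<le> Suc k" for m
  proof -
    have "degree (entry (step_mat v) m c) \<le> 1"
      using 1 by (simp add: entry_step_mat)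
    then show ?thesis
      using Suc.IH[of "next_pair v" r m]
        degree_mult_le[of "entry (quo_mat k (next_pair v)) r m" "entry (step_mat v) m c"]
      by linarith
  qed
  then show ?case
    by (simp add: entry_mult degree_add_le)
qed

section \<open>The link to the remainder sequence\<close>

definition rev_coeff :: "nat \<Rightarrow> 'a::zero poly \<Rightarrow> nat \<Rightarrow> 'a" where
  "rev_coeff d A j = (if j \<le> d then coeff A (d - j) else 0)"

definition rev_pair :: "nat \<Rightarrow> 'a::zero poly \<Rightarrow> 'a poly \<Rightarrow> nat \<Rightarrow> nat \<Rightarrow> 'a" where
  "rev_pair d A B r = rev_coeff d (if r = 0 then A else B)"

lemma degree_eq_oneE:
  assumes "degree p = 1"
  obtains a b where "p = [:b, a:]"
proof -
  obtain b q where p: "p = pCons b q" by (cases p)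
  with assms have "degree q = 0" by (auto split: if_splits)
  then obtain a where "q = [:a:]" using degree0_coeffs by blast
  then show ?thesis using that p by blast
qed

text \<open>The remainder has no coefficients in degrees \<open>d\<close> and above, so the
  coefficients of \<open>P\<close> in degrees \<open>d + 1\<close> and \<open>d\<close> come from
  the product of quotient and divisor alone.\<close>

lemma div_eq_lead_quo:
  fixes P Q :: "'a::field poly"
  assumes "degree Q = d" "Q \<noteq> 0" "degree (P div Q) = 1"
  shows "lead_quo (rev_pair (Suc d) P Q) = P div Q"
proof -
  define R where "R = P mod Q"
  obtain a b where q: "P div Q = [:b, a:]"
    using assms(3) by (rule degree_eq_oneE)
  have P: "P = [:b, a:] * Q + R"
    unfolding q[symmetric] R_def by simp
  have R: "coeff R i = 0" if "i \<ge> d" for i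
    using degree_mod_less'[of Q P] assms that unfolding R_def
    by (cases "P mod Q = 0") (auto intro!: coeff_eq_0)
  have Qz: "coeff Q (Suc d) = 0" using assms by (simp add: coeff_eq_0)
  have lc: "coeff Q d \<noteq> 0" using assms by auto
  have a: "coeff P (Suc d) = a * coeff Q d"
    unfolding P by (simp add: R Qz)
  have b: "coeff P d = b * coeff Q d + a * (if d = 0 then 0 else coeff Q (d - 1))"
    unfolding P by (cases d) (simp_all add: R)
  show ?thesis
    unfolding q using lc a b
    by (cases d) (simp_all add: lead_quo_def Let_def rev_pair_def rev_coeff_def field_simps)
qed

lemma next_rev_pair:
  fixes P Q :: "'a::field poly"
  assumes "degree Q = d" "Q \<noteq> 0" "degree (P div Q) = 1"
  shows "r < 2 \<Longrightarrow> next_pair (rev_pair (Suc d) P Q) r j = rev_pair d Q (P mod Q) r j"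
proof -
  obtain a b where q: "P div Q = [:b, a:]"
    using assms(3) by (rule degree_eq_oneE)
  have R: "P mod Q = P - [:b, a:] * Q"
    unfolding q[symmetric] by (simp add: minus_div_mult_eq_mod)
  have l: "lead_quo (rev_pair (Suc d) P Q) = [:b, a:]"
    using div_eq_lead_quo[OF assms] q by simp
  assume "r < 2"
  then consider "r = 0" | "r = Suc 0" by linarith
  then show ?thesis
  proof cases
    case 1
    then show ?thesis by (simp add: next_pair_0 rev_pair_def rev_coeff_def)
  next
    case 2
    \<comment> \<open>The case \<open>d = j\<close> is the constant coefficient, to which the linear
      term of the quotient contributes nothing: there \<open>v 1\<close> is read past its end and
      gives 0.\<close>
    consider "d < j" | "d = j" | m where "d - j = Suc m" "d - Suc j = m" "j < d"
      by (cases "d - j") fastforce+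
    then show ?thesis
      unfolding 2 next_pair_1 l R
      by cases (auto simp: rev_pair_def rev_coeff_def Suc_diff_le)
  qed
qed

lemma next_pair_cong:
  assumes "\<And>c j. c < 2 \<Longrightarrow> v c j = w c j" and "r < 2"
  shows "next_pair v r j = next_pair w r j"
proof -
  have "lead_quo v = lead_quo w" by (rule lead_quo_cong) (rule assms(1))
  then show ?thesis
    using assms by (auto simp: less_2_cases_iff next_pair_0 next_pair_1)
qed

lemma degree_eq_Suc_degree_divisor:
  fixes P Q :: "'a::field poly"
  assumes "Q \<noteq> 0" "degree (P div Q) = 1"
  shows "degree P = Suc (degree Q)"
proof -
  have q: "P div Q \<noteq> 0" using assms(2) by auto
  have "degree ((P div Q) * Q) = Suc (degree Q)"
    using assms q by (simp add: degree_mult_eq)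
  moreover have "degree (P mod Q) < degree ((P div Q) * Q)"
    using degree_mod_less[OF assms(1), of P] calculation by auto
  ultimately show ?thesis
    using degree_add_eq_left[of "P mod Q" "(P div Q) * Q"] by simp
qed

lemma mat_degree_B_mat:
  "mat_degree (B_mat P Q i) = degree (rem_seq P Q (i - 1) div rem_seq P Q i)" (is "_ = degree ?q")
proof -
  have "{degree (B_mat P Q i $ r $ c) | r c. True} =
      (\<Union>r\<in>UNIV. \<Union>c\<in>UNIV. {degree (B_mat P Q i $ r $ c)})"
    by auto
  also have "\<dots> = {0, degree ?q}"
    unfolding UNIV_2 by (auto simp: B_mat_def vector_2)
  finally show ?thesis by (simp add: mat_degree_def)
qed

text \<open>The induction also carries that the pair after \<open>m\<close> steps represents the
  remainders of indices \<open>m\<close> and \<open>m + 1\<close> for the degree bound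
  \<open>d - m\<close>. Linear quotients make the degree drop by exactly one per step, which keeps
  this normalisation exact.\<close>

lemma rem_seq_regular:
  fixes P Q :: "'a::field poly"
  assumes "degree P = d" and len: "k < rem_length P Q"
    and deg: "\<And>i. 1 \<le> i \<Longrightarrow> i \<le> k \<Longrightarrow> mat_degree (B_mat P Q i) = 1"
  shows "regular k (rev_pair d P Q)" "quo_mat k (rev_pair d P Q) = B_prod P Q 1 (k + 1)"
proof -
  let ?v = "rev_pair d P Q" and ?R = "rem_seq P Q"
  have "regular m ?v \<and> quo_mat m ?v = B_prod P Q 1 (m + 1) \<and> degree (?R m) = d - m \<and>
      (\<forall>r<2. \<forall>j. (next_pair ^^ m) ?v r j = rev_pair (d - m) (?R m) (?R (Suc m)) r j)"
    if "m \<le> k" for m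
    using that
  proof (induction m)
    case 0
    show ?case using assms(1) by simp
  next
    case (Suc m)
    define D where "D = degree (?R (Suc m))"
    define w where "w = (next_pair ^^ m) ?v"
    from Suc have IH: "regular m ?v" "quo_mat m ?v = B_prod P Q 1 (m + 1)" "degree (?R m) = d - m"
      "\<And>r j. r < 2 \<Longrightarrow> w r j = rev_pair (d - m) (?R m) (?R (Suc m)) r j"
      by (auto simp: w_def)
    have nz: "?R (Suc m) \<noteq> 0"
      using len Suc.prems not_less_Least[of "Suc m" "\<lambda>l. ?R l = 0"] unfolding rem_length_def
      by auto
    have q: "degree (?R m div ?R (Suc m)) = 1"
      using deg[of "Suc m"] Suc.prems by (simp add: mat_degree_B_mat)
    have D: "d - m = Suc D"
      using degree_eq_Suc_degree_divisor[OF nz q] IH(3) by (simp add: D_def)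
    note IH(4)[unfolded D]
    then have w: "w r j = rev_pair (Suc D) (?R m) (?R (Suc m)) r j" if "r < 2" for r j
      using that by blast
    have lq: "lead_quo w = ?R m div ?R (Suc m)"
      using lead_quo_cong[of w, OF w] div_eq_lead_quo[OF _ nz q] D_def by simp
    have "step_mat w = B_mat P Q (Suc m)"
      by (simp add: step_mat_def B_mat_def lq)
    then have "quo_mat (m + 1) ?v = B_mat P Q (Suc m) ** B_prod P Q 1 (m + 1)"
      unfolding quo_mat_add by (simp add: IH(2) w_def[symmetric])
    moreover have "regular (m + 1) ?v"
      unfolding regular_add
      using IH(1) nz w[of 1 1] by (simp add: w_def[symmetric] rev_pair_def rev_coeff_def D_def)
    moreover have "(next_pair ^^ Suc m) ?v r j = rev_pair D (?R (Suc m)) (?R (Suc (Suc m))) r j"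
      if "r < 2" for r j
    proof -
      have "(next_pair ^^ Suc m) ?v r j = next_pair w r j"
        by (simp add: w_def)
      also have "\<dots> = next_pair (rev_pair (Suc D) (?R m) (?R (Suc m))) r j"
        by (rule next_pair_cong[OF w that])
      also have "\<dots> = rev_pair D (?R (Suc m)) (?R m mod ?R (Suc m)) r j"
        by (rule next_rev_pair[OF D_def[symmetric] nz q that])
      finally show ?thesis by simp
    qed
    moreover have "d - Suc m = D" using D by simp
    ultimately show ?case by (simp add: D_def)
  qed
  from this[of k] show "regular k ?v" "quo_mat k ?v = B_prod P Q 1 (k + 1)" by auto
qed

section \<open>Products by discrete Fourier transforms\<close>

lemma sum_lessThan_add: "(\<Sum>i<a + b. f i) = (\<Sum>i<a. f i) + (\<Sum>i<b. f (a + i))"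
  for f :: "nat \<Rightarrow> 'a::comm_monoid_add"
  by (induction b) (simp_all add: add.assoc)

lemma poly_eq_sum:
  fixes X :: "'a::field poly"
  assumes "degree X < n"
  shows "poly X x = (\<Sum>i<n. coeff X i * x ^ i)"
  unfolding poly_altdef
  by (rule sum.mono_neutral_left) (use assms in \<open>auto simp: coeff_eq_0\<close>)

lemma polys_below_Poly:
  assumes "length xs = n"
  shows "Poly xs \<in> polys_below n"
proof -
  have "coeff (Poly xs) i = 0" if "n \<le> i" for i
    using that assms by (simp add: nth_default_def)
  then show ?thesis
    unfolding polys_below_def by (metis (mono_tags, lifting) leading_coeff_0_iff linorder_not_le mem_Collect_eq)
qed

lemma poly_Poly_map_upt:
  fixes f :: "nat \<Rightarrow> 'a::field"
  shows "poly (Poly (map f [0..<n])) x = (\<Sum>i<n. f i * x ^ i)"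
proof (cases "n = 0")
  case False
  have "degree (Poly (map f [0..<n])) < n"
    using polys_below_Poly[of "map f [0..<n]" n] False by (auto simp: polys_below_def)
  then show ?thesis
    by (simp add: poly_eq_sum nth_default_def)
qed simp

text \<open>For \<open>y < 2\<close> this is the power \<open>y\<close> of -1; by
  \<open>root_pow_half\<close> it is also the power \<open>h\<close> of the twist
  \<open>\<omega> (2 * h) ^ y\<close>.\<close>

definition sgn_of :: "nat \<Rightarrow> 'a::ring_1" where
  "sgn_of y = (if y \<noteq> 0 then - 1 else 1)"

context binary_FFT_model
begin

abbreviation ev where "ev \<equiv> evs N \<omega>"

section \<open>Transforms of order 2h by transforms of order h\<close>

lemma root_facts:
  assumes "2 * h \<in> N"
  shows "h \<in> N" "\<omega> h = \<omega> (2 * h) ^ 2" "\<omega> (2 * h) ^ h = - 1" "h > 0"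
proof -
  let ?z = "\<omega> (2 * h)"
  have p: "primitive_root_of_unity (2 * h) ?z" using N_roots[OF assms] .
  then show h: "h > 0" unfolding primitive_root_of_unity_def by simp
  show "h \<in> N" using N_divisors[OF assms, of h] by simp
  show "\<omega> h = ?z ^ 2" using N_divisors[OF assms, of h] h by simp
  have "?z ^ h \<noteq> 1" using p h unfolding primitive_root_of_unity_def by simp
  moreover have "(?z ^ h) ^ 2 = 1"
    using p unfolding primitive_root_of_unity_def by (simp add: power_mult[symmetric] mult.commute)
  ultimately show "?z ^ h = - 1" using power2_eq_1_iff by blast
qed

lemma root_pow_half:
  assumes "2 * h \<in> N" "y < 2"
  shows "(\<omega> (2 * h) ^ y) ^ h = sgn_of y"
  using assms root_facts(3)[OF assms(1)] by (auto simp: less_2_cases_iff sgn_of_def)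

lemma sgn_of_square: "sgn_of y * sgn_of y = (1 :: 'a)"
  by (simp add: sgn_of_def)

text \<open>The values of \<open>X\<close> at the odd (or even) powers of the root of order \<open>2h\<close> form a DFT of
  order \<open>h\<close> of the following sequence.\<close>

definition folded :: "nat \<Rightarrow> nat \<Rightarrow> 'a poly \<Rightarrow> nat \<Rightarrow> 'a" where
  "folded h y X s = (\<omega> (2 * h) ^ y) ^ s * (coeff X s + sgn_of y * coeff X (s + h) + coeff X (s + 2 * h))"

text \<open>Each of these points \<open>w\<close> satisfies \<open>w ^ h = sgn_of y\<close>, hence
  \<open>w ^ (2 * h) = 1\<close>, so the three blocks of \<open>h\<close> coefficients collapse into
  one. The factor of \<open>w ^ s\<close> that depends on \<open>y\<close> alone is moved into the
  sequence.\<close>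

lemma poly_eq_folded:
  assumes h: "2 * h \<in> N" and y: "y < 2" and X: "degree X < 3 * h"
  shows "poly X (\<omega> (2 * h) ^ (2 * i + y)) = (\<Sum>s<h. folded h y X s * (\<omega> h ^ i) ^ s)"
proof -
  let ?z = "\<omega> (2 * h)"
  define w where "w = ?z ^ (2 * i + y)"
  have "w ^ h = ((?z ^ h) ^ 2) ^ i * (?z ^ y) ^ h"
    by (simp add: w_def power_mult[symmetric] power_add[symmetric] algebra_simps)
  then have wh: "w ^ h = sgn_of y"
    using root_facts(3)[OF h] root_pow_half[OF h y] by simp
  have w: "w = ?z ^ y * \<omega> h ^ i"
    by (simp add: w_def root_facts(2)[OF h] power_mult[symmetric] power_add)
  have "poly X w = (\<Sum>s<h + (h + h). coeff X s * w ^ s)"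
    using X by (intro poly_eq_sum) simp
  also have "\<dots> = (\<Sum>s<h. coeff X s * w ^ s + (coeff X (h + s) * w ^ (h + s)
      + coeff X (h + (h + s)) * w ^ (h + (h + s))))"
    by (simp only: sum_lessThan_add sum.distrib)
  also have "\<dots> = (\<Sum>s<h. folded h y X s * (\<omega> h ^ i) ^ s)"
  proof (rule sum.cong)
    fix s
    have "w ^ (h + s) = sgn_of y * w ^ s" "w ^ (h + (h + s)) = w ^ s"
      by (simp_all add: power_add wh mult.assoc[symmetric] sgn_of_square)
    moreover have "w ^ s = (?z ^ y) ^ s * (\<omega> h ^ i) ^ s"
      by (simp only: w power_mult_distrib)
    moreover have "h + (h + s) = s + 2 * h" by simp
    ultimately show "coeff X s * w ^ s + (coeff X (h + s) * w ^ (h + s)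
      + coeff X (h + (h + s)) * w ^ (h + (h + s))) = folded h y X s * (\<omega> h ^ i) ^ s"
      unfolding folded_def by (simp only: add.commute[of h s]) (simp add: ring_distribs mult_ac)
  qed simp
  finally show ?thesis unfolding w_def .
qed

text \<open>The model only asserts that a program exists, so one is chosen; \<open>Call\<close>
  separates its recursion from that of the surrounding procedure.\<close>

definition dft :: "'a prog" where
  "dft = Call (SOME p. \<forall>n\<in>N. \<forall>A\<in>polys_below n. \<exists>c.
      run N \<omega> p (Cell (Num n) (enc_list (map (coeff A) [0..<n]))) (enc_list (DFT \<omega> n A)) c
      \<and> real c \<le> F n)"

definition idft :: "'a prog" where
  "idft = Call (SOME p. \<forall>n\<in>N. \<forall>A\<in>polys_below n. \<exists>c.
      run N \<omega> p (Cell (Num n) (enc_list (DFT \<omega> n A))) (enc_list (map (coeff A) [0..<n])) c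
      \<and> real c \<le> F n)"

lemma coeff_Poly_upt: "map (coeff (Poly (map u [0..<n]))) [0..<n] = map u [0..<n]"
  by (auto simp: nth_default_def)

lemma DFT_Poly_upt:
  "DFT \<omega> n (Poly (map u [0..<n])) = map (\<lambda>i. \<Sum>s<n. u s * (\<omega> n ^ i) ^ s) [0..<n]"
  by (simp add: DFT_def poly_Poly_map_upt)

lemma ev_dft:
  assumes n: "n \<in> N" and p: "ev s p v (Num n) a" and q: "ev s q v (etabl n u) b"
  shows "ev s (Seq (Both p q) dft) v (etabl n (\<lambda>i. \<Sum>s<n. u s * (\<omega> n ^ i) ^ s)) (a + b + F n)"
proof -
  have "ev s dft (Cell (Num n) (enc_list (map u [0..<n])))
      (enc_list (map (\<lambda>i. \<Sum>s<n. u s * (\<omega> n ^ i) ^ s) [0..<n])) (F n)"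
    using someI_ex[OF DFT_cost, rule_format, OF n polys_below_Poly[of "map u [0..<n]" n]]
    unfolding dft_def coeff_Poly_upt DFT_Poly_upt run_def
    by (intro evs_Call) (simp add: evs_def)
  then show ?thesis
    using evs_Seq[OF evs_Both[OF p q]] unfolding enc_list_map_upt by blast
qed

lemma ev_idft:
  assumes n: "n \<in> N" and p: "ev s p v (Num n) a"
    and q: "ev s q v (etabl n (\<lambda>i. \<Sum>s<n. u s * (\<omega> n ^ i) ^ s)) b"
  shows "ev s (Seq (Both p q) idft) v (etabl n u) (a + b + F n)"
proof -
  have "ev s idft (Cell (Num n) (enc_list (map (\<lambda>i. \<Sum>s<n. u s * (\<omega> n ^ i) ^ s) [0..<n])))
      (enc_list (map u [0..<n])) (F n)"
    using someI_ex[OF inverse_DFT_cost, rule_format, OF n polys_below_Poly[of "map u [0..<n]" n]]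
    unfolding idft_def coeff_Poly_upt DFT_Poly_upt run_def
    by (intro evs_Call) (simp add: evs_def)
  then show ?thesis
    using evs_Seq[OF evs_Both[OF p q]] unfolding enc_list_map_upt by blast
qed

text \<open>Repeated application of these rules follows the syntax of a program and evaluates it
  symbolically, with output and cost as unknowns; \<open>evs_weaken\<close> then compares them with
  the claimed ones.\<close>

lemmas evs_rules = evs_Var_0 evs_Var_Suc evs_Let evs_args_Nil evs_args_Cons evs_nat_bin
  evs_fadd evs_fsub evs_fmul evs_tab evs_get evs_getc evs_If_field NatConst[THEN evs_free]
  FieldConst[THEN evs_free]

definition tables :: "'a prog" where
  "tables = tab (NatConst 2) (powers V2 (If_field V0 (Seq V1 Root) (FieldConst 1)))"

text \<open>The row \<open>y = 0\<close> consists of ones, so that both parities are served by the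
  same programs. Twisting reads a row at \<open>h - s\<close>, untwisting at
  \<open>s\<close>.\<close>

definition tables_val :: "nat \<Rightarrow> 'a val" where
  "tables_val h = tabl 2 (\<lambda>y. etabl (Suc h) (\<lambda>t. (\<omega> (2 * h) ^ y) ^ (h - t)))"

lemma ev_tables:
  assumes "2 * h \<in> N"
  shows "ev s tables (stack [Num (2 * h), Num h]) (tables_val h) (2 * h)"
  unfolding tables_def
  apply (rule evs_weaken)
  apply (rule evs_rules evs_powers | assumption)+
           apply (rule evs_Seq)
            apply (rule evs_rules)+
           apply (rule evs_free, rule Root, rule assms)
          apply (rule evs_rules)+
       apply (simp_all add: tables_val_def)
  by (auto intro!: tabl_cong simp: less_2_cases_iff)

definition sgn_prog :: "'a prog \<Rightarrow> 'a prog" where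
  "sgn_prog p = If_field p (FieldConst (- 1)) (FieldConst 1)"

lemma ev_sgn_prog: "ev s p v (Num y) 0 \<Longrightarrow> ev s (sgn_prog p) v (Elem (sgn_of y)) 0"
  unfolding sgn_prog_def sgn_of_def
  by (rule evs_weaken, rule evs_If_field, assumption, (rule evs_rules)+) auto

text \<open>For degree below \<open>2 * h\<close> only two of the three blocks of
  \<open>folded\<close> occur. The three operations per coefficient are the sign, the addition and
  the twist.\<close>

definition twisted_dft :: "'a prog" where
  "twisted_dft = Seq (Both V3 (tab V3
     (get (get V3 V1) (V4 \<ominus> V0) *\<^sub>f (getc V2 V0 +\<^sub>f sgn_prog V1 *\<^sub>f getc V2 (V0 \<oplus> V4))))) dft"

lemma ev_twisted_dft:
  assumes h: "2 * h \<in> N" and y: "y < 2" and X: "degree X < 2 * h" "degree X < m"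
  shows "ev s twisted_dft (stack [Num y, etabl m (coeff X), tables_val h, Num h])
    (etabl h (\<lambda>i. poly X (\<omega> (2 * h) ^ (2 * i + y)))) (F h + 3 * h)"
  unfolding twisted_dft_def tables_val_def
  apply (rule evs_weaken)
    apply (rule ev_dft)
      apply (rule root_facts(1)[OF h])
     apply (rule evs_rules refl ev_sgn_prog | (simp add: y; fail))+
  using X h y
   apply (auto intro!: tabl_cong sum.cong simp: poly_eq_folded folded_def coeff_eq_0 root_facts)
  done

text \<open>As \<open>(\<omega> (2 * h) ^ y) ^ h = sgn_of y\<close>, the product of \<open>sgn_of y\<close> with the entry \<open>s\<close> of the
  table, which is stored in reverse order, is the inverse power \<open>\<omega> (2 * h) ^ (- y * s)\<close>.\<close>

definition untwist :: "'a prog" where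
  "untwist = Let_in
     (tab (NatConst 2) (Let_in (Seq (Both V3 (get V1 V0)) idft)
        (tab V4 (sgn_prog V2 *\<^sub>f get (get V4 V2) V0 *\<^sub>f get V1 V0))))
     (tab (NatConst 2 \<otimes> V3) (If_field (V4 \<ominus> V0)
        ((get (get V1 (NatConst 0)) V0 +\<^sub>f get (get V1 (NatConst 1)) V0) *\<^sub>f FieldConst (1 / 2))
        ((get (get V1 (NatConst 0)) (V0 \<ominus> V4) -\<^sub>f get (get V1 (NatConst 1)) (V0 \<ominus> V4))
          *\<^sub>f FieldConst (1 / 2))))"

text \<open>The coefficients of \<open>X\<close> modulo x^(2h) - 1 when the degree is below
  \<open>3 * h\<close>: only the lower half receives wrapped coefficients.\<close>

definition cyclic :: "nat \<Rightarrow> 'a poly \<Rightarrow> nat \<Rightarrow> 'a" where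
  "cyclic h X s = (if s < h then coeff X s + coeff X (s + 2 * h) else coeff X s)"

lemma untwist_folded:
  assumes h: "2 * h \<in> N" and y: "y < 2" and s: "s < h"
  shows "sgn_of y * (\<omega> (2 * h) ^ y) ^ (h - s) * folded h y X s =
    coeff X s + sgn_of y * coeff X (s + h) + coeff X (s + 2 * h)"
proof -
  let ?g = "\<omega> (2 * h) ^ y"
  have "?g ^ (h - s) * ?g ^ s = sgn_of y"
    using s root_pow_half[OF h y] by (simp add: power_add[symmetric])
  then have "sgn_of y * ?g ^ (h - s) * folded h y X s = sgn_of y * sgn_of y *
      (coeff X s + sgn_of y * coeff X (s + h) + coeff X (s + 2 * h))"
    unfolding folded_def by (metis (no_types, lifting) mult.assoc)
  then show ?thesis by (simp add: sgn_of_square)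
qed

lemma ev_untwist:
  assumes h: "2 * h \<in> N" and X: "degree X < 3 * h"
  shows "ev s untwist (stack [tabl 2 (\<lambda>y. etabl h (\<lambda>i. poly X (\<omega> (2 * h) ^ (2 * i + y)))),
      tables_val h, Num h]) (etabl (2 * h) (cyclic h X)) (2 * F h + 8 * h)"
proof -
  define e where "e y i = (\<Sum>s<h. folded h y X s * (\<omega> h ^ i) ^ s)" for y i
  have E: "tabl 2 (\<lambda>y. etabl h (\<lambda>i. poly X (\<omega> (2 * h) ^ (2 * i + y)))) = tabl 2 (\<lambda>y. etabl h (e y))"
    by (intro tabl_cong) (simp add: e_def poly_eq_folded[OF h _ X])
  \<comment> \<open>Half the sum of the untwisted sequences for the two parities is the lower half
    of \<open>cyclic\<close>, half their difference the upper half. Here 2 must be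
    invertible.\<close>
  have eq: "(x + 1 * b + c + (x + - 1 * b + c)) * (1 / 2) = x + c"
    "(x + 1 * b + c - (x + - 1 * b + c)) * (1 / 2) = b" for x b c :: 'a
    using two_invertible by (simp_all add: field_simps)
  show ?thesis
    unfolding E unfolding untwist_def tables_val_def
    apply (rule evs_weaken)
      apply (rule evs_rules refl ev_sgn_prog | (rule ev_idft, rule root_facts(1)[OF h])
        | (simp add: e_def; fail))+
    subgoal
      unfolding apply_nat_op.simps
    proof (rule tabl_cong)
      fix i assume i: "i < 2 * h"
      show "Elem (if h - i \<noteq> 0
          then (sgn_of 0 * (\<omega> (2 * h) ^ 0) ^ (h - i) * folded h 0 X i +
            sgn_of 1 * (\<omega> (2 * h) ^ 1) ^ (h - i) * folded h 1 X i) * (1 / 2)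
          else (sgn_of 0 * (\<omega> (2 * h) ^ 0) ^ (h - (i - h)) * folded h 0 X (i - h) -
            sgn_of 1 * (\<omega> (2 * h) ^ 1) ^ (h - (i - h)) * folded h 1 X (i - h)) * (1 / 2)) =
        Elem (cyclic h X i)"
      proof (cases "i < h")
        case True
        then show ?thesis
          by (simp only: untwist_folded[OF h _ True]) (simp add: cyclic_def sgn_of_def eq[simplified])
      next
        case False
        then have "i - h < h" "i - h + h = i" "h - i = 0" using i by simp_all
        then show ?thesis using False
          by (simp only: untwist_folded[OF h]) (simp add: cyclic_def sgn_of_def eq[simplified])
      qed
    qed
    subgoal by simp
    done
qed

lemma ev_Seq_untwist:
  assumes h: "2 * h \<in> N"
    and p: "ev s p v (tabl 2 (\<lambda>y. etabl h (e y))) a" "ev s t v (tables_val h) b" "ev s q v (Num h) c"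
    and e: "\<And>y i. y < 2 \<Longrightarrow> i < h \<Longrightarrow> e y i = poly X (\<omega> (2 * h) ^ (2 * i + y))"
    and X: "degree X < 3 * h"
  shows "ev s (Seq (args [p, t, q]) untwist) v (etabl (2 * h) (cyclic h X)) (a + b + c + 2 * F h + 8 * h)"
proof -
  have "tabl 2 (\<lambda>y. etabl h (e y)) = tabl 2 (\<lambda>y. etabl h (\<lambda>i. poly X (\<omega> (2 * h) ^ (2 * i + y))))"
    by (intro tabl_cong) (simp add: e)
  with p(1) have p1: "ev s p v \<dots> a" by simp
  show ?thesis
    by (rule evs_weaken, rule evs_Seq, (rule evs_rules p1 p(2,3))+, rule ev_untwist[OF h X]) simp_all
qed

lemma ev_Seq_twisted_dft:
  assumes h: "2 * h \<in> N"
    and p: "ev s p v (Num y) a" "ev s q v (etabl m u) b" "ev s t v (tables_val h) c"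
      "ev s r v (Num h) d"
    and y: "y < 2" and m: "m \<le> 2 * h" "m > 0"
  shows "ev s (Seq (args [p, q, t, r]) twisted_dft) v
    (etabl h (\<lambda>i. poly (Poly (map u [0..<m])) (\<omega> (2 * h) ^ (2 * i + y)))) (a + b + c + d + F h + 3 * h)"
proof -
  let ?X = "Poly (map u [0..<m])"
  have X: "degree ?X < m"
    using polys_below_Poly[of "map u [0..<m]" m] m by (auto simp: polys_below_def)
  have u: "etabl m u = etabl m (coeff ?X)"
    by (rule tabl_cong) (simp add: nth_default_def)
  show ?thesis
    apply (rule evs_weaken)
      apply (rule evs_Seq)
       apply (rule evs_rules p(1,3,4) p(2)[unfolded u])+
      apply (rule ev_twisted_dft[OF h y, of ?X m])
    using X m by simp_all
qed

section \<open>Matrices as tables of coefficients and of values\<close>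

definition coeffs_val :: "nat \<Rightarrow> 'a poly ^ 2 ^ 2 \<Rightarrow> 'a val" where
  "coeffs_val h A = tabl 2 (\<lambda>r. tabl 2 (\<lambda>c. etabl (Suc h) (coeff (entry A r c))))"

text \<open>Entries may have degree \<open>h\<close>, so these \<open>h\<close> values alone do not
  determine them; \<open>coeffs_val\<close> is therefore kept alongside.\<close>

definition dft_val :: "nat \<Rightarrow> 'a poly ^ 2 ^ 2 \<Rightarrow> 'a val" where
  "dft_val h A = tabl 2 (\<lambda>r. tabl 2 (\<lambda>c. etabl h (\<lambda>i. poly (entry A r c) (\<omega> h ^ i))))"

text \<open>The transform of order \<open>2 * h\<close>, split by the parity of the exponent. The
  half \<open>y = 0\<close> equals \<open>dft_val h A\<close>, so only the other half has to be
  computed.\<close>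

definition hat_val :: "nat \<Rightarrow> 'a poly ^ 2 ^ 2 \<Rightarrow> 'a val" where
  "hat_val h A = tabl 2 (\<lambda>y. tabl 2 (\<lambda>r. tabl 2 (\<lambda>c.
     etabl h (\<lambda>i. poly (entry A r c) (\<omega> (2 * h) ^ (2 * i + y))))))"

definition hat :: "'a prog" where
  "hat = args [V1, tab (NatConst 2) (tab (NatConst 2)
     (Seq (args [NatConst 1, get (get V2 V1) V0, V4, V5]) twisted_dft))]"

lemma Poly_coeffs_upt: "degree A < m \<Longrightarrow> Poly (map (coeff A) [0..<m]) = A"
  by (rule poly_eqI) (auto simp: nth_default_def coeff_eq_0)

lemma ev_hat:
  assumes h: "2 * h \<in> N" and A: "\<And>r c. degree (entry A r c) \<le> h"
  shows "ev s hat (stack [coeffs_val h A, dft_val h A, tables_val h, Num h]) (hat_val h A)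
    (4 * F h + 12 * h)"
proof -
  have m: "Suc h \<le> 2 * h" using root_facts(4)[OF h] by simp
  show ?thesis
    unfolding hat_def coeffs_val_def
    apply (rule evs_weaken)
      apply (rule evs_rules refl ev_Seq_twisted_dft[OF h] m | (simp; fail))+
    subgoal
      by (simp add: hat_val_def tabl_2 dft_val_def Poly_coeffs_upt A le_imp_less_Suc
          root_facts(2)[OF h] power_mult del: upt_Suc)
    subgoal by simp
    done
qed

section \<open>Applying a matrix by middle products\<close>

text \<open>These are the terms of \<open>f\<close> from \<open>(1 + b) * h\<close> to
  \<open>(3 + b) * h - 1\<close>, exactly those on which a block of \<open>h\<close> outputs
  depends. The reversal turns the correlation \<open>act\<close> into a polynomial product.\<close>

definition window :: "nat \<Rightarrow> nat \<Rightarrow> (nat \<Rightarrow> 'a) \<Rightarrow> 'a poly" where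
  "window h b f = Poly (map (\<lambda>s. f ((3 + b) * h - 1 - s)) [0..<2 * h])"

definition windows_val :: "nat \<Rightarrow> (nat \<Rightarrow> nat \<Rightarrow> 'a) \<Rightarrow> 'a val" where
  "windows_val h v = tabl 2 (\<lambda>y. tabl 2 (\<lambda>b. tabl 2 (\<lambda>c.
     etabl h (\<lambda>i. poly (window h b (v c)) (\<omega> (2 * h) ^ (2 * i + y))))))"

definition windows :: "'a prog" where
  "windows = tab (NatConst 2) (tab (NatConst 2) (tab (NatConst 2)
     (Seq (args [V2, tab (NatConst 2 \<otimes> V5)
        (getc (get V4 V1) ((NatConst 3 \<oplus> V2) \<otimes> V6 \<ominus> NatConst 1 \<ominus> V0)), V4, V5]) twisted_dft)))"

definition pair_val :: "(nat \<Rightarrow> nat) \<Rightarrow> (nat \<Rightarrow> nat \<Rightarrow> 'a) \<Rightarrow> 'a val" where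
  "pair_val m v = tabl 2 (\<lambda>c. etabl (m c) (v c))"

lemma ev_windows:
  assumes h: "2 * h \<in> N" and v: "\<And>c j. c < 2 \<Longrightarrow> m c \<le> j \<Longrightarrow> v c j = 0"
  shows "ev s windows (stack [pair_val m v, tables_val h, Num h]) (windows_val h v)
    (8 * F h + 24 * h)"
  unfolding windows_def pair_val_def
  apply (rule evs_weaken)
    apply (rule evs_rules refl ev_Seq_twisted_dft[OF h] | (simp add: root_facts(4)[OF h]; fail))+
  subgoal
    unfolding apply_nat_op.simps windows_val_def window_def
    apply (intro tabl_cong)
    apply (intro arg_cong[where f = Elem] arg_cong2[where f = poly] arg_cong[where f = Poly] refl map_cong)
    apply (use v in auto)
    done
  subgoal by simp
  done

lemma coeff_window: "coeff (window h b f) s = (if s < 2 * h then f ((3 + b) * h - 1 - s) else 0)"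
  by (simp add: window_def nth_default_def)

lemma degree_window: "h > 0 \<Longrightarrow> degree (window h b f) < 2 * h"
  using polys_below_Poly[of "map (\<lambda>s. f ((3 + b) * h - 1 - s)) [0..<2 * h]" "2 * h"]
  by (auto simp: polys_below_def window_def)

text \<open>A middle product: the upper half of a cyclic product of order \<open>2h\<close> contains no wrapped
  coefficients.\<close>

lemma cyclic_window:
  assumes h: "h > 0" and A: "degree A \<le> h" "degree B \<le> h" and j: "j < 2 * h"
  shows "cyclic h (A * window h (j div h) f + B * window h (j div h) g) (2 * h - 1 - j mod h) =
    act A f (j + h) + act B g (j + h)"
proof -
  define s where "s = 2 * h - 1 - j mod h"
  have jm: "j mod h < h" using h by simp
  then have s: "\<not> s < h" by (simp add: s_def)
  have j_eq: "j = (j div h) * h + j mod h" by simp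
  have "coeff (A * window h (j div h) f) s = act A f (j + h)"
    if A: "degree A \<le> h" for A and f :: "nat \<Rightarrow> 'a"
  proof -
    have "coeff (A * window h (j div h) f) s =
      (\<Sum>i\<le>s. coeff A i * coeff (window h (j div h) f) (s - i))"
      by (rule coeff_mult)
    also have "\<dots> = (\<Sum>i\<le>h. coeff A i * coeff (window h (j div h) f) (s - i))"
      by (rule sum.mono_neutral_right) (use s A in \<open>auto simp: coeff_eq_0\<close>)
    also have "\<dots> = (\<Sum>i\<le>h. coeff A i * f (i + (j + h)))"
    proof (rule sum.cong)
      fix i assume "i \<in> {..h}"
      then have i: "i \<le> h" by simp
      have "(3 + j div h) * h - 1 - (s - i) = i + ((j div h) * h + j mod h + h)"
        using i jm unfolding s_def by (simp add: algebra_simps)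
      then have "(3 + j div h) * h - 1 - (s - i) = i + (j + h)"
        using j_eq by presburger
      moreover have "s - i < 2 * h" using h by (simp add: s_def)
      ultimately show "coeff A i * coeff (window h (j div h) f) (s - i) = coeff A i * f (i + (j + h))"
        by (simp add: coeff_window)
    qed simp
    also have "\<dots> = act A f (j + h)" by (rule act_bound[OF A, symmetric])
    finally show ?thesis .
  qed
  then show ?thesis
    using A s unfolding s_def[symmetric] cyclic_def by simp
qed

text \<open>By \<open>quo_mat_cong\<close>, the next call of size \<open>h\<close> needs
  \<open>2 * h + 1\<close> terms per component. Two windows give \<open>2 * h\<close> of them; the
  last one is computed by \<open>fsum\<close> as a direct sum with \<open>O(h)\<close>
  operations.\<close>

definition apply_prog :: "'a prog" where
  "apply_prog = Let_in (Seq (args [V2, V3, V4]) windows)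
    (Let_in
      (tab (NatConst 2) (tab (NatConst 2) (Seq (args
        [tab (NatConst 2) (tab V8
          (get (get (get (get V6 V1) V3) (NatConst 0)) V0 *\<^sub>f get (get (get (get V4 V1) V2) (NatConst 0)) V0
          +\<^sub>f get (get (get (get V6 V1) V3) (NatConst 1)) V0 *\<^sub>f get (get (get (get V4 V1) V2) (NatConst 1)) V0)),
         V6, V7]) untwist)))
    (Let_in
      (tab (NatConst 2) (fsum (V7 \<oplus> NatConst 1)
        (get (get (get V4 V1) (NatConst 0)) V0 *\<^sub>f getc (get V6 (NatConst 0)) (NatConst 3 \<otimes> V8 \<oplus> V0)
        +\<^sub>f get (get (get V4 V1) (NatConst 1)) V0 *\<^sub>f getc (get V6 (NatConst 1)) (NatConst 3 \<otimes> V8 \<oplus> V0))))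
    (tab (NatConst 2) (tab (NatConst 2 \<otimes> V8 \<oplus> NatConst 1)
      (If_field (NatConst 2 \<otimes> V9 \<ominus> V0)
        (get (get (get V3 V1) (ndiv V0 V9)) (NatConst 2 \<otimes> V9 \<ominus> NatConst 1 \<ominus> nmod V0 V9))
        (get V2 V1))))))"

lemma ev_apply_prog:
  assumes h: "2 * h \<in> N" and A: "\<And>r c. degree (entry A r c) \<le> h"
    and v: "\<And>c j. c < 2 \<Longrightarrow> m c \<le> j \<Longrightarrow> v c j = 0"
  shows "ev s apply_prog
      (stack [coeffs_val h A, hat_val h A, pair_val m v, tables_val h, Num h])
      (pair_val (\<lambda>_. 2 * h + 1) (\<lambda>r j. mact A v r (j + h)))
      (16 * F h + 100 * h)"
proof -
  have h0: "h > 0" by (rule root_facts(4)[OF h])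
  define X where "X r b = entry A r 0 * window h b (v 0) + entry A r 1 * window h b (v 1)" for r b
  have X: "degree (X r b) < 3 * h" for r b
  proof -
    have "degree (entry A r c * window h b f) < 3 * h" for c f
      using degree_mult_le[of "entry A r c" "window h b f"] A[of r c] degree_window[OF h0, of b f]
      by linarith
    then show ?thesis
      unfolding X_def by (intro degree_add_less)
  qed
  have untwist_X: "ev s (Seq (args [tab (NatConst 2) (tab V8
          (get (get (get (get V6 V1) V3) (NatConst 0)) V0 *\<^sub>f get (get (get (get V4 V1) V2) (NatConst 0)) V0
          +\<^sub>f get (get (get (get V6 V1) V3) (NatConst 1)) V0 *\<^sub>f get (get (get (get V4 V1) V2) (NatConst 1)) V0)),
         V6, V7]) untwist)
      (stack [Num b, Num r, windows_val h v, coeffs_val h A, hat_val h A, pair_val m v, tables_val h, Num h])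
      (etabl (2 * h) (cyclic h (X r b))) (2 * F h + 14 * h)"
    if "r < 2" "b < 2" for r b s
    unfolding windows_val_def hat_val_def
    apply (rule evs_weaken)
      apply (rule ev_Seq_untwist[OF h _ _ _ _ X[of r b]])
         apply (rule evs_rules refl | (simp add: that; fail))+
      apply (simp add: X_def)
     apply (rule refl)
    by simp
  have L: "v c (3 * h + i) = v c (i + (2 * h + h))" for c i
    by (simp add: add.commute)
  show ?thesis
    unfolding apply_prog_def
    apply (rule evs_weaken)
      apply (rule evs_Let)
       apply (rule evs_Seq)
        apply (rule evs_rules)+
       apply (rule ev_windows[OF h v], assumption, assumption)
      apply (rule evs_Let)
       apply (rule evs_tab, rule evs_rules)
       apply (rule evs_tab, rule evs_rules)
       apply (rule untwist_X, assumption, assumption)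
      apply (unfold coeffs_val_def pair_val_def)
      apply (rule evs_rules evs_fsum refl | (simp add: h0 less_mult_imp_div_less; fail))+
    subgoal
      unfolding apply_nat_op.simps
    proof (intro tabl_cong, goal_cases)
      case (1 r j)
      show ?case
      proof (cases "j < 2 * h")
        case True
        then show ?thesis
          using cyclic_window[OF h0 A[of r 0] A[of r 1] True, of "v 0" "v 1"]
          by (simp add: X_def mact_def)
      next
        case False
        then have "j = 2 * h" using 1 by simp
        then show ?thesis
          using v
          by (simp add: mact_def act_bound[OF A] lessThan_Suc_atMost sum.distrib)
             (auto intro!: arg_cong2[where f = "(+)"] sum.cong simp: add_ac)
      qed
    qed
    subgoal
      using h0 by simp
    done
qed

section \<open>The product of two matrices\<close>

text \<open>The degree bounds leave only the term \<open>i = h\<close> of the convolution. This is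
  the coefficient that a product modulo x^(2h) - 1 wraps onto the constant one.\<close>

lemma coeff_mult_top:
  fixes A B :: "'a poly"
  assumes "degree A \<le> h" "degree B \<le> h"
  shows "coeff (A * B) (2 * h) = coeff A h * coeff B h"
proof -
  have "coeff A i * coeff B (2 * h - i) = 0" if "i \<noteq> h" for i
    using that assms by (cases "i < h") (simp_all add: coeff_eq_0)
  then have "coeff (A * B) (2 * h) = (\<Sum>i\<in>{h}. coeff A i * coeff B (2 * h - i))"
    unfolding coeff_mult by (intro sum.mono_neutral_right) auto
  then show ?thesis by (simp add: mult_2)
qed

definition result_val :: "nat \<Rightarrow> 'a poly ^ 2 ^ 2 \<Rightarrow> 'a val" where
  "result_val h A = Cell (coeffs_val h A) (dft_val h A)"

text \<open>The pointwise products are the values of the product at all roots of order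
  \<open>2 * h\<close>; interleaving the parities turns them into the \<open>dft_val\<close> of the
  result without a further transform. The top coefficients are computed directly and subtracted from
  the constant ones of the cyclic product.\<close>

definition mult_prog :: "'a prog" where
  "mult_prog = Let_in
      (tab (NatConst 2) (tab (NatConst 2) (tab (NatConst 2) (tab V8
        (get (get (get (get V5 V1) V3) (NatConst 0)) V0 *\<^sub>f get (get (get (get V7 V1) (NatConst 0)) V2) V0
        +\<^sub>f get (get (get (get V5 V1) V3) (NatConst 1)) V0 *\<^sub>f get (get (get (get V7 V1) (NatConst 1)) V2) V0)))))
    (Let_in (tab (NatConst 2) (tab (NatConst 2) (Seq (args [get (get V2 V1) V0, V7, V8]) untwist)))
    (Let_in
      (tab (NatConst 2) (tab (NatConst 2)
        (get (get (get V4 V1) (NatConst 0)) V9 *\<^sub>f get (get (get V6 (NatConst 0)) V0) V9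
        +\<^sub>f get (get (get V4 V1) (NatConst 1)) V9 *\<^sub>f get (get (get V6 (NatConst 1)) V0) V9)))
    (Both
      (tab (NatConst 2) (tab (NatConst 2) (tab (NatConst 2 \<otimes> V10 \<oplus> NatConst 1)
        (If_field V0
          (If_field (NatConst 2 \<otimes> V11 \<ominus> V0) (get (get (get V4 V2) V1) V0) (get (get V3 V2) V1))
          (get (get (get V4 V2) V1) (NatConst 0) -\<^sub>f get (get V3 V2) V1)))))
      (tab (NatConst 2) (tab (NatConst 2) (tab (NatConst 2 \<otimes> V10)
        (get (get (get (get V5 V2) V1) (nmod V0 (NatConst 2))) (ndiv V0 (NatConst 2)))))))))"

lemma ev_mult_prog:
  assumes h: "2 * h \<in> N" and A: "\<And>r c. degree (entry A r c) \<le> h" "\<And>r c. degree (entry B r c) \<le> h"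
  shows "ev s mult_prog
      (stack [coeffs_val h B, hat_val h B, coeffs_val h A, hat_val h A, tables_val h, Num h])
      (result_val (2 * h) (B ** A)) (8 * F h + 100 * h)"
proof -
  have h0: "h > 0" by (rule root_facts(4)[OF h])
  have dX: "degree (entry (B ** A) r c) \<le> 2 * h" for r c
  proof -
    have "degree (entry B r m * entry A m c) \<le> 2 * h" for m
      using degree_mult_le[of "entry B r m" "entry A m c"] A(1)[of m c] A(2)[of r m] by linarith
    then show ?thesis unfolding entry_mult by (intro degree_add_le)
  qed
  have X: "degree (entry (B ** A) r c) < 3 * h" for r c
    using dX[of r c] h0 by linarith
  have zero: "coeff (entry (B ** A) r c) i = 0" if "2 * h < i" for r c i
    using dX[of r c] that by (intro coeff_eq_0) linarith
  have top: "coeff (entry B r 0) h * coeff (entry A 0 c) h + coeff (entry B r 1) h * coeff (entry A 1 c) h =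
      coeff (entry (B ** A) r c) (2 * h)" for r c
    by (simp add: entry_mult coeff_mult_top A)
  have poly: "poly (entry B r 0) x * poly (entry A 0 c) x + poly (entry B r 1) x * poly (entry A 1 c) x =
      poly (entry (B ** A) r c) x" for r c x
    by (simp add: entry_mult)
  have untwist_X: "ev s (Seq (args [get (get V2 V1) V0, V7, V8]) untwist)
      (stack [Num c, Num r, tabl 2 (\<lambda>r. tabl 2 (\<lambda>c. tabl 2 (\<lambda>y. etabl h (\<lambda>i.
          poly (entry (B ** A) r c) (\<omega> (2 * h) ^ (2 * i + y)))))), x1, x2, x3, x4, tables_val h, Num h])
      (etabl (2 * h) (cyclic h (entry (B ** A) r c))) (2 * F h + 8 * h)"
    if "r < 2" "c < 2" for r c s x1 x2 x3 x4
    apply (rule evs_weaken)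
      apply (rule ev_Seq_untwist[OF h _ _ _ _ X[of r c]])
         apply (rule evs_rules refl | (simp add: that; fail))+
    done
  show ?thesis
    unfolding mult_prog_def
    unfolding coeffs_val_def hat_val_def
    apply (rule evs_weaken)
      apply (rule evs_Let)
       apply (rule evs_rules refl | (simp; fail))+
      apply (unfold poly)
       apply (rule untwist_X, assumption, assumption)
      apply (rule evs_rules refl | (simp; fail))+
      apply (unfold top)
      apply (rule evs_Both)
       apply (rule evs_rules refl | (simp add: h0; fail))+
    subgoal
      unfolding apply_nat_op.simps result_val_def coeffs_val_def dft_val_def
    proof (intro arg_cong2[where f = Cell], goal_cases)
      case 1
      show ?case
        unfolding Suc_eq_plus1
        by (intro tabl_cong) (auto simp: cyclic_def zero h0 not_less intro: arg_cong[where f = "coeff _"])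
    next
      case 2
      show ?case
        by (intro tabl_cong) simp
    qed
    subgoal
      using h0 by simp
    done
qed

end

section \<open>The half-gcd algorithm\<close>

context binary_FFT_model
begin

section \<open>The leaves of the recursion\<close>

text \<open>Subtraction is truncated, so the sum of both differences vanishes exactly if row and
  column agree. Thus the identity costs no field operations.\<close>

definition one_prog :: "'a prog" where
  "one_prog = Both
     (tab (NatConst 2) (tab (NatConst 2) (tab (V2 \<oplus> NatConst 1)
       (If_field (V2 \<ominus> V1 \<oplus> (V1 \<ominus> V2) \<oplus> V0) (FieldConst 0) (FieldConst 1)))))
     (tab (NatConst 2) (tab (NatConst 2) (tab V2
       (If_field (V2 \<ominus> V1 \<oplus> (V1 \<ominus> V2)) (FieldConst 0) (FieldConst 1)))))"

lemma ev_one_prog: "ev s one_prog (stack [Num n, k, v]) (result_val n (mat 1)) 0"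
  unfolding one_prog_def
  apply (rule evs_weaken)
    apply (rule evs_Both)
     apply (rule evs_rules)+
  subgoal
    unfolding apply_nat_op.simps result_val_def coeffs_val_def dft_val_def
    unfolding Suc_eq_plus1
    by (intro arg_cong2[where f = Cell] tabl_cong) (auto simp: entry_one)
  subgoal by simp
  done

text \<open>The pushed values are the linear and then the constant coefficient of
  \<open>lead_quo v\<close>. A transform of order 1 is the value at 1, hence the sum of the
  coefficients.\<close>

definition base_prog :: "'a prog" where
  "base_prog = Let_in
      (getc (get V2 (NatConst 0)) (NatConst 0) /\<^sub>f getc (get V2 (NatConst 1)) (NatConst 1))
    (Let_in
      ((getc (get V3 (NatConst 0)) (NatConst 1) -\<^sub>f V0 *\<^sub>f getc (get V3 (NatConst 1)) (NatConst 2))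
        /\<^sub>f getc (get V3 (NatConst 1)) (NatConst 1))
    (let zero = FieldConst 0; one = FieldConst 1 in Both
      (args [args [args [zero, zero], args [one, zero]],
             args [args [one, zero], args [zero -\<^sub>f V0, zero -\<^sub>f V1]]])
      (args [args [args [zero], args [one]], args [args [one], args [zero -\<^sub>f V0 -\<^sub>f V1]]])))"

lemma ev_base_prog:
  assumes v: "\<And>c j. c < 2 \<Longrightarrow> m c \<le> j \<Longrightarrow> v c j = 0" and nz: "v 1 1 \<noteq> 0"
  shows "ev s base_prog (stack [Num 1, k, pair_val m v]) (result_val 1 (quo_mat 1 v)) 20"
proof -
  have v': "(if j < m c then v c j else 0) = v c j" if "c < 2" for c j
    using v[OF that, of j] by auto
  have v0: "(if j < m 0 then v 0 j else 0) = v 0 j"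
    and v1: "(if j < m 1 then v 1 j else 0) = v 1 j" for j
    using v'[of 0 j] v'[of 1 j] by simp_all
  have "m 1 > 1" using v[of 1 1] nz by (meson leI one_less_numeral_iff semiring_norm(76))
  note nz' = this[simplified] nz[simplified]
  show ?thesis
    unfolding base_prog_def pair_val_def Let_def
    apply (rule evs_weaken)
      apply (rule evs_rules evs_fdiv evs_Both refl | (simp add: v' nz'; fail))+
    subgoal
      unfolding result_val_def coeffs_val_def dft_val_def tabl_2 v0 v1
      by (simp add: tabl_def entry_mult entry_one entry_step_mat lead_quo_def Let_def nz')
    subgoal by simp
    done
qed

text \<open>The last step runs on the stack
  \<open>[hat of r2, r2, v', hat of r1, tables, r1, k1, h, n, k, v]\<close>, where \<open>r1\<close> and \<open>r2\<close> are the
  results of the recursive calls and \<open>k1 = min k h\<close>.\<close>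

definition rec_prog :: "'a prog" where
  "rec_prog = Let_in (ndiv V0 (NatConst 2))
    (Let_in (V2 \<ominus> (V2 \<ominus> V0))
    (Let_in (Seq (args [V1, V0, V4]) Self)
    (Let_in (Seq (args [V3, V2]) tables)
    (Let_in (Seq (args [Seq V1 Head, Seq V1 Tail, V0, V3]) hat)
    (Let_in (Seq (args [Seq V2 Head, V0, V7, V1, V4]) apply_prog)
    (Let_in (Seq (args [V5, V7 \<ominus> V4, V0]) Self)
    (Let_in (Seq (args [Seq V0 Head, Seq V0 Tail, V3, V6]) hat)
    (Seq (args [Seq V1 Head, V0, Seq V5 Head, V3, V4, V7]) mult_prog))))))))"

text \<open>The 32 transforms are 4 for each of the two runs of \<open>hat\<close>, 16 for
  \<open>apply_prog\<close> and 8 for \<open>mult_prog\<close>. The recursive calls enter as the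
  hypotheses \<open>r1\<close> and \<open>r2\<close>, to be supplied by the induction.\<close>

lemma ev_rec_prog:
  assumes h: "2 * h \<in> N"
    and v: "\<And>c j. c < 2 \<Longrightarrow> m c \<le> j \<Longrightarrow> v c j = 0"
    and A: "\<And>r c. degree (entry A r c) \<le> h" and B: "\<And>r c. degree (entry B r c) \<le> h"
    and r1: "ev s Self (stack [Num h, Num (k - (k - h)), pair_val m v]) (result_val h A) a"
    and r2: "ev s Self (stack [Num h, Num (k - (k - (k - h))),
        pair_val (\<lambda>_. 2 * h + 1) (\<lambda>r j. mact A v r (j + h))]) (result_val h B) b"
  shows "ev s rec_prog (stack [Num (2 * h), Num k, pair_val m v]) (result_val (2 * h) (B ** A))
    (a + b + 32 * F h + 300 * h)"
proof -
  have h2: "2 * h div 2 = h" by simp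
  show ?thesis
    unfolding rec_prog_def result_val_def
    apply (rule evs_weaken)
      apply (rule evs_rules)+
      apply (unfold apply_nat_op.simps h2)
      apply (rule evs_Seq, (rule evs_rules)+, rule r1[unfolded result_val_def])
      apply (rule evs_Let, rule evs_Seq, (rule evs_rules)+, rule ev_tables[OF h])
      apply (rule evs_Let, rule evs_Seq, (rule evs_rules evs_Seq evs_prims)+, rule ev_hat[OF h A])
      apply (rule evs_Let, rule evs_Seq, (rule evs_rules evs_Seq evs_prims)+,
        rule ev_apply_prog[OF h A], erule (1) v)
      apply (rule evs_Let, rule evs_Seq, (rule evs_rules)+, unfold apply_nat_op.simps,
        rule r2[unfolded result_val_def])
      apply (rule evs_Let, rule evs_Seq, (rule evs_rules evs_Seq evs_prims)+, rule ev_hat[OF h B])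
      apply (rule evs_Seq, (rule evs_rules evs_Seq evs_prims)+, rule ev_mult_prog[OF h A B])
    subgoal by (simp add: result_val_def)
    subgoal by simp
    done
qed

section \<open>The recursion and its correctness\<close>

definition half_gcd :: "'a prog" where
  "half_gcd = IfNum V1 (IfNum (V0 \<ominus> NatConst 1) rec_prog base_prog) one_prog"

text \<open>Bounds a call of size \<open>2 ^ p\<close> with \<open>k\<close> steps. A call with
  \<open>k = 0\<close> only writes the identity, so an empty second half is free.\<close>

fun cost :: "nat \<Rightarrow> nat \<Rightarrow> real" where
  "cost p 0 = 0"
| "cost 0 (Suc k) = 20"
| "cost (Suc p) (Suc k) = cost p (min (Suc k) (2 ^ p)) + cost p (Suc k - min (Suc k) (2 ^ p)) +
    32 * F (2 ^ p) + 300 * 2 ^ p"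

lemma ev_half_gcd:
  assumes "2 ^ p \<in> N" "k \<le> 2 ^ p" "regular k v"
    and "\<And>c j. c < 2 \<Longrightarrow> m c \<le> j \<Longrightarrow> v c j = 0"
  shows "ev half_gcd half_gcd (stack [Num (2 ^ p), Num k, pair_val m v])
    (result_val (2 ^ p) (quo_mat k v)) (cost p k)"
  using assms
proof (induction p arbitrary: k v m)
  case 0
  show ?case
  proof (cases "k = 0")
    case True
    show ?thesis
      unfolding True half_gcd_def
      by (rule evs_weaken, rule evs_If_false, (rule evs_rules)+, rule ev_one_prog) simp_all
  next
    case False
    with 0 have k: "k = 1" by simp
    have nz: "v 1 1 \<noteq> 0" using 0(3) by (simp add: k)
    have "ev half_gcd half_gcd (stack [Num 1, Num 1, pair_val m v]) (result_val 1 (quo_mat 1 v)) 20"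
      apply (subst (2) half_gcd_def)
      apply (rule evs_weaken)
        apply (rule evs_If_true, (rule evs_rules)+, simp)
        apply (rule evs_If_false, rule evs_weaken, (rule evs_rules)+, simp, rule order_refl)
        apply (rule ev_base_prog, erule (1) 0(4), rule nz)
       apply simp_all
      done
    then show ?thesis by (simp add: k)
  qed
next
  case (Suc p)
  let ?h = "2 ^ p :: nat"
  have h: "2 * ?h \<in> N" using Suc.prems(1) by simp
  show ?case
  proof (cases "k = 0")
    case True
    show ?thesis
      unfolding True half_gcd_def
      by (rule evs_weaken, rule evs_If_false, (rule evs_rules)+, rule ev_one_prog) simp_all
  next
    case False
    define k1 where "k1 = min k ?h"
    have k1: "k - (k - ?h) = k1" "k1 \<le> ?h" "k - k1 \<le> ?h" "k1 + (k - k1) = k"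
      using Suc.prems(2) by (auto simp: k1_def)
    define A where "A = quo_mat k1 v"
    \<comment> \<open>The data handed to the second call are cut off after \<open>2 * h + 1\<close>
      terms; \<open>w\<close> extends them by zeros, as the induction hypothesis requires.\<close>
    define w where "w r j = (if j < 2 * ?h + 1 then mact A v r (j + ?h) else 0)" for r j
    have w: "pair_val (\<lambda>_. 2 * ?h + 1) (\<lambda>r j. mact A v r (j + ?h)) = pair_val (\<lambda>_. 2 * ?h + 1) w"
      unfolding pair_val_def by (intro tabl_cong) (simp add: w_def)
    have reg: "regular k1 v" "regular (k - k1) ((next_pair ^^ k1) v)"
      using Suc.prems(3) regular_add[of k1 "k - k1" v] k1(4) by auto
    \<comment> \<open>The program always shifts by \<open>h\<close>. This is the right shift if
      \<open>k1 = h\<close>, and then \<open>quo_mat_cong\<close> ignores the truncation; otherwise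
      no steps remain and the data are irrelevant.\<close>
    have *: "quo_mat (k - k1) w = quo_mat (k - k1) ((next_pair ^^ k1) v) \<and>
        regular (k - k1) w = regular (k - k1) ((next_pair ^^ k1) v)"
    proof (cases "k1 = ?h")
      case True
      show ?thesis
        by (rule quo_mat_cong)
          (use k1 in \<open>auto simp: w_def A_def funpow_next_pair True\<close>)
    next
      case False
      then have "k - k1 = 0" by (auto simp: k1_def min_def split: if_splits)
      then show ?thesis by simp
    qed
    have self: "ev half_gcd Self (stack [Num ?h, Num k', pair_val m' v'])
        (result_val ?h (quo_mat k' v')) (cost p k')"
      if "k' \<le> ?h" "regular k' v'" "\<And>c j. c < 2 \<Longrightarrow> m' c \<le> j \<Longrightarrow> v' c j = 0" for k' m' v'
      using that root_facts(1)[OF h] by (intro evs_Self Suc.IH)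
    have "ev half_gcd rec_prog (stack [Num (2 * ?h), Num k, pair_val m v])
      (result_val (2 * ?h) (quo_mat (k - k1) w ** A)) (cost p k1 + cost p (k - k1) + 32 * F ?h + real (300 * ?h))"
    proof (rule ev_rec_prog[OF h])
      show "v c j = 0" if "c < 2" "m c \<le> j" for c j
        using that by (rule Suc.prems(4))
      show "degree (entry A r c) \<le> ?h" for r c
        unfolding A_def using degree_quo_mat[of k1 v r c] k1(2) by linarith
      show "degree (entry (quo_mat (k - k1) w) r c) \<le> ?h" for r c
        using degree_quo_mat[of "k - k1" w r c] k1(3) by linarith
      show "ev half_gcd Self (stack [Num ?h, Num (k - (k - ?h)), pair_val m v]) (result_val ?h A) (cost p k1)"
        unfolding k1 A_def by (rule self[OF k1(2) reg(1) Suc.prems(4)])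
      show "ev half_gcd Self (stack [Num ?h, Num (k - (k - (k - ?h))),
          pair_val (\<lambda>_. 2 * ?h + 1) (\<lambda>r j. mact A v r (j + ?h))])
          (result_val ?h (quo_mat (k - k1) w)) (cost p (k - k1))"
        unfolding k1 w by (rule self[OF k1(3)]) (use * reg(2) in \<open>auto simp: w_def\<close>)
    qed
    moreover have "quo_mat (k - k1) w ** A = quo_mat k v"
      using * quo_mat_add[of k1 "k - k1" v] k1(4) by (simp add: A_def)
    moreover have "cost (Suc p) k = cost p k1 + cost p (k - k1) + 32 * F ?h + 300 * real ?h"
      using False by (cases k) (simp_all add: k1_def)
    ultimately have rec: "ev half_gcd rec_prog (stack [Num (2 * ?h), Num k, pair_val m v])
      (result_val (2 * ?h) (quo_mat k v)) (cost (Suc p) k)" by simp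
    have ne: "2 * ?h - 1 \<noteq> 0"
      using one_le_power[of "2 :: nat" p] by linarith
    have "ev half_gcd half_gcd (stack [Num (2 * ?h), Num k, pair_val m v])
      (result_val (2 * ?h) (quo_mat k v)) (cost (Suc p) k)"
      apply (subst (2) half_gcd_def)
      apply (rule evs_weaken)
        apply (rule evs_If_true, (rule evs_rules)+, rule False)
        apply (rule evs_If_true, (rule evs_rules)+, unfold apply_nat_op.simps, rule ne)
        apply (rule rec)
       apply simp_all
      done
    then show ?thesis by simp
  qed
qed

end

section \<open>Input and output conversion\<close>

definition list_length :: "'a prog" where
  "list_length = Call (IfNum IsNul (NatConst 0) (NatConst 1 \<oplus> Seq Tail Self))"

lemma evs_list_length: "evs N \<omega> s list_length (enc_list xs) (Num (length xs)) 0"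
  unfolding list_length_def
proof (rule evs_Call)
  let ?p = "IfNum IsNul (NatConst 0) (NatConst 1 \<oplus> Seq Tail Self)"
  show "evs N \<omega> ?p ?p (enc_list xs) (Num (length xs)) 0"
  proof (induction xs)
    case Nil
    show ?case
      by (rule evs_weaken, rule evs_If_true, (rule evs_prims)+, simp, (rule evs_prims)+) simp_all
  next
    case (Cons x xs)
    have 1: "evs N \<omega> ?p IsNul (enc_list (x # xs)) (Num 0) 0"
      using evs_prims(5)[of N \<omega> ?p "enc_list (x # xs)"] by simp
    have "evs N \<omega> ?p (NatConst 1 \<oplus> Seq Tail Self) (enc_list (x # xs))
        (Num (apply_nat_op NAdd 1 (length xs))) (0 + (0 + 0))"
      unfolding enc_list.simps
      by (rule evs_nat_bin, rule evs_prims, rule evs_Seq, rule evs_prims, rule evs_Self, rule Cons.IH)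
    from evs_If_false[OF 1 this] show ?case by simp
  qed
qed

text \<open>The recursion treats the tail first and tests an entry only if nothing is left after it,
  which is the behaviour of \<open>cCons\<close>; every entry is tested at most once.\<close>

definition strip_zeros :: "'a prog" where
  "strip_zeros = Call (IfNum IsNul NulConst (Seq (Both Head (Seq Tail Self))
     (IfNum (Seq Tail IsNul) (IfNum (Seq Head IsZero) NulConst Input) Input)))"

lemma evs_strip_zeros: "evs N \<omega> s strip_zeros (enc_list xs) (enc_poly (Poly xs)) (length xs)"
  unfolding strip_zeros_def
proof (rule evs_Call)
  let ?q = "IfNum (Seq Tail IsNul) (IfNum (Seq Head IsZero) NulConst Input) Input"
  let ?p = "IfNum IsNul NulConst (Seq (Both Head (Seq Tail Self)) ?q)"
  have q: "evs N \<omega> ?p ?q (enc_list (x # ys)) (enc_list (cCons x ys)) 1" for x ys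
  proof -
    have 1: "evs N \<omega> ?p (Seq Tail IsNul) (enc_list (x # ys)) (Num (if ys = [] then 1 else 0)) (0 + 0)"
    proof -
      have "evs N \<omega> ?p IsNul (enc_list ys) (Num (if ys = [] then 1 else 0)) 0"
        using evs_prims(5)[of N \<omega> ?p "enc_list ys"] by (cases ys) simp_all
      from evs_Seq[OF evs_prims(3) this] show ?thesis by simp
    qed
    have 2: "evs N \<omega> ?p (Seq Head IsZero) (enc_list (x # ys)) (Num (if x = 0 then 1 else 0)) (0 + 1)"
      unfolding enc_list.simps by (rule evs_Seq, rule evs_prims, rule evs_IsZero)
    show ?thesis
    proof (cases "ys = []")
      case False
      with 1 have "evs N \<omega> ?p (Seq Tail IsNul) (enc_list (x # ys)) (Num 0) 0" by simp
      then show ?thesis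
        using False by (intro evs_weaken[OF evs_If_false[OF _ evs_prims(1)]]) (auto simp: cCons_def)
    next
      case True
      with 1 have t: "evs N \<omega> ?p (Seq Tail IsNul) (enc_list (x # ys)) (Num 1) 0" by simp
      show ?thesis
      proof (cases "x = 0")
        case True
        with 2 have "evs N \<omega> ?p (Seq Head IsZero) (enc_list (x # ys)) (Num 1) 1" by simp
        then show ?thesis
          using t True \<open>ys = []\<close>
          by (intro evs_weaken[OF evs_If_true[OF _ _ evs_If_true[OF _ _ evs_prims(4)]]]) (auto simp: cCons_def)
      next
        case False
        with 2 have "evs N \<omega> ?p (Seq Head IsZero) (enc_list (x # ys)) (Num 0) 1" by simp
        then show ?thesis
          using t False \<open>ys = []\<close>
          by (intro evs_weaken[OF evs_If_true[OF _ _ evs_If_false[OF _ evs_prims(1)]]]) (auto simp: cCons_def)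
      qed
    qed
  qed
  show "evs N \<omega> ?p ?p (enc_list xs) (enc_poly (Poly xs)) (length xs)"
  proof (induction xs)
    case Nil
    show ?case
      by (rule evs_weaken, rule evs_If_true, (rule evs_prims)+, simp, (rule evs_prims)+)
        (simp_all add: enc_poly_def)
  next
    case (Cons x xs)
    have 1: "evs N \<omega> ?p IsNul (enc_list (x # xs)) (Num 0) 0"
      using evs_prims(5)[of N \<omega> ?p "enc_list (x # xs)"] by simp
    have "evs N \<omega> ?p (Both Head (Seq Tail Self)) (enc_list (x # xs))
        (enc_list (x # coeffs (Poly xs))) (0 + (0 + real (length xs)))"
      unfolding enc_list.simps
      by (rule evs_Both, rule evs_prims, rule evs_Seq, rule evs_prims, rule evs_Self,
          rule Cons.IH[unfolded enc_poly_def])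
    from evs_If_false[OF 1 evs_Seq[OF this q]] show ?case
      by (simp add: enc_poly_def add.commute)
  qed
qed

definition pow2_above :: "'a prog" where
  "pow2_above = Seq (Both Input (NatConst 1))
     (Call (IfNum (Head \<ominus> Tail) (Seq (Both Head (NatConst 2 \<otimes> Tail)) Self) Tail))"

lemma evs_pow2_above:
  assumes k: "k \<le> 2 ^ p" and p: "\<And>q. q < p \<Longrightarrow> 2 ^ q < k"
  shows "evs N \<omega> s pow2_above (Num k) (Num (2 ^ p)) 0"
proof -
  let ?p = "IfNum (Head \<ominus> Tail) (Seq (Both Head (NatConst 2 \<otimes> Tail)) Self) Tail"
  \<comment> \<open>The loop state is \<open>k\<close> with the current power; the claim for a
    general start \<open>2 ^ q\<close> is proved downwards from \<open>q = p\<close>.\<close>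
  have *: "evs N \<omega> ?p ?p (Cell (Num k) (Num (2 ^ q))) (Num (2 ^ p)) 0" if "q \<le> p" for q
    using that
  proof (induction q rule: inc_induct)
    case base
    have "evs N \<omega> ?p (Head \<ominus> Tail) (Cell (Num k) (Num (2 ^ p))) (Num 0) (0 + 0)"
      by (rule evs_weaken, rule evs_nat_bin, (rule evs_prims)+) (use k in simp_all)
    from evs_If_false[OF this evs_prims(3)] show ?case by simp
  next
    case (step q)
    have 1: "evs N \<omega> ?p (Head \<ominus> Tail) (Cell (Num k) (Num (2 ^ q))) (Num (k - 2 ^ q)) (0 + 0)"
      by (rule evs_weaken, rule evs_nat_bin, (rule evs_prims)+) simp_all
    have 2: "evs N \<omega> ?p (Both Head (NatConst 2 \<otimes> Tail)) (Cell (Num k) (Num (2 ^ q)))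
        (Cell (Num k) (Num (2 ^ Suc q))) (0 + (0 + 0))"
      by (rule evs_weaken, rule evs_Both, rule evs_prims, rule evs_nat_bin, (rule evs_prims)+) simp_all
    have "k - 2 ^ q \<noteq> 0" using p[of q] step by simp
    from evs_If_true[OF 1 this evs_Seq[OF 2 evs_Self[OF step.IH]]] show ?case by simp
  qed
  have "evs N \<omega> s pow2_above (Num k) (Num (2 ^ p)) (0 + 0 + 0)"
    unfolding pow2_above_def
    by (rule evs_Seq, rule evs_Both, (rule evs_prims)+, rule evs_Call) (use *[of 0] in simp)
  then show ?thesis by simp
qed

lemma evs_getc_poly:
  assumes "evs N \<omega> s p v (enc_poly P) a" "evs N \<omega> s i v (Num j) b"
  shows "evs N \<omega> s (getc p i) v (Elem (coeff P j)) (a + b)"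
proof -
  have "(if j < length (coeffs P) then map Elem (coeffs P) ! j else Elem 0) = Elem (coeff P j)"
    by (auto simp: nth_default_coeffs_eq[symmetric] nth_default_def)
  then show ?thesis
    using evs_get_gen[OF assms(1)[unfolded enc_poly_def enc_list_eq_vlist] assms(2)]
    by (simp add: getc_def)
qed

context binary_FFT_model
begin

text \<open>Both lists are reversed relative to the degree of \<open>P\<close>, obtained from the
  length of its list; \<open>getc\<close> pads the shorter list of \<open>Q\<close> with
  zeros.\<close>

definition main_prog :: "'a prog" where
  "main_prog = Seq (args [Head, Seq Tail Head, Seq Tail Tail])
    (Let_in (Seq V2 pow2_above)
    (Let_in (Seq V1 list_length)
    (Let_in (args [tab V0 (getc V3 (V1 \<ominus> NatConst 1 \<ominus> V0)), tab V0 (getc V4 (V1 \<ominus> NatConst 1 \<ominus> V0))])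
    (Let_in (Seq (args [V2, V5, V0]) (Call half_gcd))
    (Both
      (Both (Seq (get (get (Seq V0 Head) (NatConst 0)) (NatConst 0)) strip_zeros)
            (Seq (get (get (Seq V0 Head) (NatConst 0)) (NatConst 1)) strip_zeros))
      (Both (Seq (get (get (Seq V0 Head) (NatConst 1)) (NatConst 0)) strip_zeros)
            (Seq (get (get (Seq V0 Head) (NatConst 1)) (NatConst 1)) strip_zeros)))))))"

lemma ev_strip_coeffs:
  assumes "ev s q v (coeffs_val n A) a" "ev s i v (Num r) 0" "ev s j v (Num c) 0" "r < 2" "c < 2"
    and A: "degree (entry A r c) \<le> n"
  shows "ev s (Seq (get (get q i) j) strip_zeros) v (enc_poly (entry A r c)) (a + n + 1)"
proof -
  have "ev s (get (get q i) j) v (enc_list (map (coeff (entry A r c)) [0..<Suc n])) (a + 0 + 0)"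
    unfolding enc_list_map_upt
    by (rule evs_get, rule evs_get, rule assms(1)[unfolded coeffs_val_def]) (rule assms refl)+
  from evs_Seq[OF this evs_strip_zeros] show ?thesis
    by (rule evs_weaken) (simp_all add: Poly_coeffs_upt A le_imp_less_Suc del: upt_Suc)
qed

lemma ev_main_prog:
  assumes P: "degree P = d" "d \<ge> 1" and Q: "degree Q \<le> d"
    and p: "2 ^ p \<in> N" "k \<le> 2 ^ p" "\<And>q. q < p \<Longrightarrow> 2 ^ q < k"
    and reg: "regular k (rev_pair d P Q)"
  shows "ev s main_prog (Cell (enc_poly P) (Cell (enc_poly Q) (Num k)))
    (enc_mat (quo_mat k (rev_pair d P Q))) (cost p k + 4 * (2 ^ p + 1))"
proof -
  let ?v = "rev_pair d P Q" let ?A = "quo_mat k ?v"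
  have len: "length (coeffs P) = Suc d"
    using P by (subst length_coeffs) auto
  have ll: "ev s list_length (enc_poly P) (Num (Suc d)) 0" for s
    using evs_list_length[of N \<omega> s "coeffs P"] by (simp add: len enc_poly_def)
  have v: "stack [etabl (Suc d) (\<lambda>j. coeff P (d - j)), etabl (Suc d) (\<lambda>j. coeff Q (d - j))] =
      pair_val (\<lambda>_. Suc d) ?v"
    unfolding pair_val_def tabl_2 vlist.simps
    by (intro arg_cong2[where f = Cell] refl tabl_cong)
      (auto simp: rev_pair_def rev_coeff_def)
  have "degree (entry ?A r c) \<le> 2 ^ p" for r c
    using degree_quo_mat[of k ?v r c] p(2) by linarith
  note strip = ev_strip_coeffs[where A = ?A, OF _ _ _ _ _ this]
  have hg: "ev s (Call half_gcd) (stack [Num (2 ^ p), Num k, pair_val (\<lambda>_. Suc d) ?v])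
      (result_val (2 ^ p) ?A) (cost p k)" for s
    by (rule evs_Call, rule ev_half_gcd[OF p(1,2) reg]) (auto simp: rev_pair_def rev_coeff_def)
  have eq: "enc_mat ?A = Cell (Cell (enc_poly (entry ?A 0 0)) (enc_poly (entry ?A 0 1)))
      (Cell (enc_poly (entry ?A 1 0)) (enc_poly (entry ?A 1 1)))"
    by (simp add: enc_mat_def entry_def)
  show ?thesis
    unfolding main_prog_def eq
    apply (rule evs_weaken)
      apply (rule evs_Seq)
       apply (rule evs_rules evs_Seq evs_prims)+
      apply (rule evs_pow2_above[OF p(2,3)], assumption)
      apply (rule evs_Let, rule evs_Seq, (rule evs_rules)+, rule ll)
      apply (rule evs_getc_poly evs_rules)+
      apply (unfold apply_nat_op.simps diff_Suc_1 v)
      apply (rule evs_Seq, (rule evs_rules)+, rule hg)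
      apply (unfold result_val_def)
      apply (rule evs_Both strip evs_rules evs_Seq evs_prims | (simp; fail))+
    done
qed

section \<open>Summing the costs over the recursion\<close>

context
  fixes \<beta> c :: real and p K :: nat
  assumes \<beta>: "\<beta> \<ge> 0" and c: "c \<ge> 0" and K: "K \<ge> 1" and Kp: "\<And>j. j < p \<Longrightarrow> 2 ^ j < K"
    and F_le: "\<And>j. j < p \<Longrightarrow> F (2 ^ j) \<le> 2 ^ j * (\<beta> * j / 6 + c)"
begin

text \<open>Divided by the size, the step from \<open>j\<close> to \<open>Suc j\<close> adds
  \<open>8 / 3 * \<beta> * j + 16 * c + 150\<close>. Summing the first term over the levels gives at
  most \<open>4 / 3 * \<beta> * j\<^sup>2\<close>, which is the origin of the factor 4/3.\<close>

lemma cost_power_le: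
  "j \<le> p \<Longrightarrow> cost j (2 ^ j) \<le> 2 ^ j * (20 + 4 / 3 * \<beta> * j\<^sup>2 + (16 * c + 150) * j)"
proof (induction j)
  case 0
  show ?case using cost.simps(2)[of 0] by simp
next
  case (Suc j)
  obtain k where k: "2 ^ Suc j = Suc k" by (metis Suc_pred' zero_less_numeral zero_less_power)
  then have "2 * 2 ^ j = Suc k" by simp
  then have m: "min (Suc k) (2 ^ j) = 2 ^ j" "Suc k - 2 ^ j = 2 ^ j" by auto
  have "cost (Suc j) (2 ^ Suc j) = 2 * cost j (2 ^ j) + 32 * F (2 ^ j) + 300 * 2 ^ j"
    unfolding k cost.simps m by simp
  also have "\<dots> \<le> 2 * (2 ^ j * (20 + 4 / 3 * \<beta> * j\<^sup>2 + (16 * c + 150) * j)) +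
      32 * (2 ^ j * (\<beta> * j / 6 + c)) + 300 * 2 ^ j"
    using Suc F_le[of j] by (intro add_mono mult_left_mono) auto
  also have "\<dots> = 2 ^ Suc j * (20 + 4 / 3 * \<beta> * (j\<^sup>2 + 2 * j) + (16 * c + 150) * Suc j)"
    by (simp add: algebra_simps)
  also have "\<dots> \<le> 2 ^ Suc j * (20 + 4 / 3 * \<beta> * (Suc j)\<^sup>2 + (16 * c + 150) * Suc j)"
    using \<beta> c by (intro mult_left_mono add_mono) (auto simp: power2_eq_square algebra_simps)
  finally show ?case .
qed

text \<open>If \<open>k\<close> exceeds half the size, the first call is full and covered by
  \<open>cost_power_le\<close>; otherwise the second call is free. So only one call per level is
  left to the induction, and the overheads, at most \<open>2 ^ q * B\<close> for a node of size
  \<open>2 ^ Suc q\<close>, form a geometric series.\<close>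

lemma cost_le:
  defines "L \<equiv> log 2 K"
  defines "A \<equiv> 20 + 4 / 3 * \<beta> * L\<^sup>2 + (16 * c + 150) * L"
    and "B \<equiv> 32 * (\<beta> * L / 6 + c) + 300"
  assumes "q \<le> p" "k \<le> 2 ^ q" "k \<le> K"
  shows "cost q k \<le> k * A + 2 ^ q * B"
  using assms(4-)
proof (induction q arbitrary: k)
  have L: "L \<ge> 0" using K by (simp add: L_def)
  have A: "A \<ge> 20" and B: "B \<ge> 0"
    using L \<beta> c by (simp_all add: A_def B_def)
  have le_L: "real j \<le> L" if "2 ^ j \<le> K" for j
    using that K unfolding L_def by (simp add: le_log_iff powr_realpow)
  {
    case 0
    then consider "k = 0" | "k = 1" by force
    then show ?case using A B cost.simps(2)[of 0] by cases auto
  next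
    case (Suc q)
    have qK: "2 ^ q < K" using Kp[of q] Suc.prems by simp
    have step: "32 * F (2 ^ q) + 300 * 2 ^ q \<le> 2 ^ q * B"
    proof -
      have "F (2 ^ q) \<le> 2 ^ q * (\<beta> * q / 6 + c)" using F_le[of q] Suc.prems by simp
      also have "\<dots> \<le> 2 ^ q * (\<beta> * L / 6 + c)"
        using le_L[of q] qK \<beta> by (intro mult_left_mono add_mono divide_right_mono) auto
      finally show ?thesis by (simp add: B_def algebra_simps)
    qed
    show ?case
    proof (cases k)
      case 0
      then show ?thesis using A B by simp
    next
      case (Suc k')
      have c1: "cost (Suc q) k = cost q (min k (2 ^ q)) + cost q (k - min k (2 ^ q)) +
          32 * F (2 ^ q) + 300 * 2 ^ q"
        by (simp add: Suc)
      show ?thesis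
      proof (cases "k \<le> 2 ^ q")
        case True
        then have "cost q k \<le> k * A + 2 ^ q * B" using Suc.IH[of k] Suc.prems by simp
        then show ?thesis using c1 True step by simp
      next
        case False
        have "cost q (2 ^ q) \<le> 2 ^ q * (20 + 4 / 3 * \<beta> * q\<^sup>2 + (16 * c + 150) * q)"
          using cost_power_le[of q] Suc.prems by simp
        also have "\<dots> \<le> 2 ^ q * A"
          unfolding A_def using le_L[of q] qK \<beta> c
          by (intro mult_left_mono add_mono power_mono) auto
        finally have 1: "cost q (2 ^ q) \<le> 2 ^ q * A" .
        have 2: "cost q (k - 2 ^ q) \<le> real (k - 2 ^ q) * A + 2 ^ q * B"
          using Suc.IH[of "k - 2 ^ q"] Suc.prems by simp
        have "real (k - 2 ^ q) = real k - 2 ^ q" using False by (simp add: of_nat_diff)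
        then show ?thesis using c1 False step 1 2 by (simp add: algebra_simps min_def)
      qed
    qed
  }
qed

end

text \<open>The quotient \<open>\<beta>\<close> of \<open>M K\<close> by \<open>K * log 2 K\<close>
  serves all levels, by monotonicity of such quotients, and makes the leading term of
  \<open>cost_le\<close> exactly \<open>4 / 3 * M K * log 2 K\<close>.\<close>

lemma cost_bound:
  obtains C where
    "\<And>K p. 2 \<le> K \<Longrightarrow> K \<le> 2 ^ p \<Longrightarrow> (\<And>j. j < p \<Longrightarrow> 2 ^ j < K) \<Longrightarrow> 2 ^ p \<in> N \<Longrightarrow>
      cost p K + 4 * (2 ^ p + 1) \<le> 4 / 3 * M K * log 2 K + C * M K"
proof -
  obtain C0 where C0: "\<And>d. d \<in> N \<Longrightarrow> \<bar>M d - 6 * F d\<bar> \<le> C0 * real d"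
    using M_F by blast
  \<comment> \<open>The first summand absorbs the linear difference between \<open>M\<close> and
    \<open>6 * F\<close>; the second covers size 1, where the logarithm vanishes.\<close>
  define c where "c = \<bar>C0\<bar> / 6 + \<bar>F 1\<bar>"
  \<comment> \<open>\<open>64 / 6\<close> comes from \<open>2 ^ p * B\<close> with
    \<open>2 ^ p\<close> at most \<open>2 * K\<close>; the other summand collects what is of order
    \<open>K * log 2 K\<close>, measured against \<open>M 2 / 2\<close>, the quotient of
    \<open>M d\<close> by \<open>d * log 2 d\<close> at \<open>d = 2\<close>.\<close>
  define C where "C = (780 + 80 * c) / (M 2 / 2) + 64 / 6"
  have c: "c \<ge> 0" by (simp add: c_def)
  have "cost p K + 4 * (2 ^ p + 1) \<le> 4 / 3 * M K * log 2 K + C * M K"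
    if K: "2 \<le> K" "K \<le> 2 ^ p" and Kp: "\<And>j. j < p \<Longrightarrow> 2 ^ j < K" and p: "2 ^ p \<in> N" for K p
  proof -
    define L where "L = log 2 K"
    define \<beta> where "\<beta> = M K / (K * L)"
    have L: "L \<ge> 1" using K by (simp add: L_def le_log_iff)
    have M2: "M 2 / 2 > 0" using M_pos[of 2] by simp
    have \<beta>_ge: "M d / (d * log 2 d) \<le> \<beta>" if "2 \<le> d" "d \<le> K" for d
      using monotone_onD[OF M_mono2, of d K] that unfolding \<beta>_def L_def by simp
    have \<beta>2: "M 2 / 2 \<le> \<beta>" using \<beta>_ge[of 2] K by simp
    have \<beta>: "\<beta> > 0" using M2 \<beta>2 by linarith
    have MK: "M K = \<beta> * (K * L)" using K L by (simp add: \<beta>_def)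
    have F_le: "F (2 ^ j) \<le> 2 ^ j * (\<beta> * j / 6 + c)" if j: "j < p" for j
    proof (cases "j = 0")
      case True
      have "F 1 \<le> c" by (simp add: c_def)
      then show ?thesis using True by simp
    next
      case False
      have "(2::nat) ^ j dvd 2 ^ p" using j by (simp add: le_imp_power_dvd)
      then have N: "2 ^ j \<in> N" using N_divisors[OF p] by blast
      have "M (2 ^ j) / (2 ^ j * j) \<le> \<beta>"
        using \<beta>_ge[of "2 ^ j"] Kp[OF j] False self_le_power[of "2 :: nat" j]
        by (simp add: log_nat_power)
      then have "M (2 ^ j) \<le> 2 ^ j * (\<beta> * j)"
        using False by (simp add: divide_le_eq mult_ac)
      moreover have "6 * F (2 ^ j) \<le> M (2 ^ j) + C0 * 2 ^ j"
        using C0[OF N] by simp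
      moreover have "C0 * 2 ^ j \<le> 6 * (2 ^ j * c)"
      proof -
        have "C0 \<le> 6 * c" by (simp add: c_def)
        then have "C0 * 2 ^ j \<le> 6 * c * 2 ^ j" by (intro mult_right_mono) auto
        then show ?thesis by (simp add: mult_ac)
      qed
      ultimately have "6 * F (2 ^ j) \<le> 2 ^ j * (\<beta> * j) + 6 * (2 ^ j * c)" by linarith
      then show ?thesis by (simp add: algebra_simps)
    qed
    have K1: "K \<ge> 1" using K by simp
    define A where "A = 20 + 4 / 3 * \<beta> * L\<^sup>2 + (16 * c + 150) * L"
    define B where "B = 32 * (\<beta> * L / 6 + c) + 300"
    have "cost p K \<le> K * A + 2 ^ p * B"
      unfolding A_def B_def L_def
      by (rule cost_le[OF less_imp_le[OF \<beta>] c K1 Kp F_le]) (use K in auto)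
    have pK: "2 ^ p \<le> 2 * real K"
    proof (cases p)
      case (Suc q)
      have "(2 ^ q :: nat) < K" using Kp[of q] Suc by simp
      then have "real (2 ^ q) \<le> real K" by (simp only: of_nat_le_iff)
      then show ?thesis using Suc by simp
    qed (use K in simp)
    have B0: "B \<ge> 0" using \<beta> L c by (simp add: B_def)
    have KL: "real K \<le> K * L" using mult_left_mono[OF L, of "real K"] by simp
    have "cost p K + 4 * (2 ^ p + 1) \<le> K * A + 2 * real K * B + (8 * real K + 4)"
    proof (rule add_mono)
      show "cost p K \<le> K * A + 2 * real K * B"
        using \<open>cost p K \<le> _\<close> mult_right_mono[OF pK B0] by (rule order_trans[OF _ add_left_mono])
      show "4 * (2 ^ p + 1) \<le> 8 * real K + 4" using pK by simp
    qed
    also have "\<dots> \<le> K * A + 2 * real K * B + 10 * real K"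
      using K by simp
    also have "\<dots> = 4 / 3 * (\<beta> * (K * L)) * L + 64 / 6 * (\<beta> * (K * L)) +
        (16 * c + 150) * (K * L) + (630 + 64 * c) * K"
      by (simp add: A_def B_def algebra_simps power2_eq_square)
    also have "\<dots> \<le> 4 / 3 * (\<beta> * (K * L)) * L + 64 / 6 * (\<beta> * (K * L)) +
        (16 * c + 150) * (K * L) + (630 + 64 * c) * (K * L)"
      using KL c by (intro add_left_mono mult_left_mono) auto
    also have "\<dots> = 4 / 3 * M K * L + 64 / 6 * M K + (780 + 80 * c) * (K * L)"
      unfolding MK by (simp add: algebra_simps)
    also have "(780 + 80 * c) * (K * L) \<le> (780 + 80 * c) / (M 2 / 2) * M K"
    proof -
      have "M 2 / 2 * (K * L) \<le> M K"
        unfolding MK using \<beta>2 L by (intro mult_right_mono) auto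
      then have "K * L \<le> M K / (M 2 / 2)"
        using M2 by (simp add: le_divide_eq mult.commute)
      then have "(780 + 80 * c) * (K * L) \<le> (780 + 80 * c) * (M K / (M 2 / 2))"
        using c by (intro mult_left_mono) auto
      then show ?thesis by (simp only: times_divide_eq_right times_divide_eq_left)
    qed
    finally show ?thesis by (simp add: C_def L_def algebra_simps)
  qed
  then show thesis by (rule that)
qed

lemma least_power_of_two:
  obtains p where "k \<le> 2 ^ p" "\<And>q. q < p \<Longrightarrow> 2 ^ q < (k :: nat)"
proof -
  have "\<exists>p. k \<le> 2 ^ p" using less_exp[of k] less_imp_le by blast
  then have "k \<le> 2 ^ (LEAST p. k \<le> 2 ^ p)" by (rule LeastI_ex)
  moreover have "2 ^ q < k" if "q < (LEAST p. k \<le> 2 ^ p)" for q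
    using not_less_Least[OF that] by simp
  ultimately show thesis by (rule that)
qed

section \<open>The complexity bound\<close>

theorem half_gcd_cost:
  "\<exists>(alg :: 'a prog) (err :: nat \<Rightarrow> real). err \<in> O(M) \<and>
    (\<forall>(P :: 'a poly) (Q :: 'a poly) (d :: nat) (k :: nat).
      degree P = d \<and> d \<ge> 1 \<and> Q \<noteq> 0 \<and> degree Q = d - 1 \<and> k \<le> d \<and>
      (\<exists>n\<in>N. d < n) \<and>
      k < rem_length P Q \<and> (\<forall>i\<in>{1..k}. mat_degree (B_mat P Q i) = 1)
      \<longrightarrow> (\<exists>c. run N \<omega> alg (Cell (enc_poly P) (Cell (enc_poly Q) (Num k)))
                         (enc_mat (B_prod P Q 1 (k + 1))) c \<and>
               real c \<le> 4 / 3 * M k * log 2 (real k) + err k))"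
proof -
  obtain C where C: "\<And>K p. 2 \<le> K \<Longrightarrow> K \<le> 2 ^ p \<Longrightarrow> (\<And>j. j < p \<Longrightarrow> 2 ^ j < K) \<Longrightarrow>
      2 ^ p \<in> N \<Longrightarrow> cost p K + 4 * (2 ^ p + 1) \<le> 4 / 3 * M K * log 2 K + C * M K"
    using cost_bound by metis
  \<comment> \<open>For \<open>k < 2\<close> the main term is 0, as \<open>log 2 0 = 0\<close>. Then
    \<open>p = 0\<close>, and 28 covers the 20 operations of the base case and the 8 for stripping
    zeros.\<close>
  define err where "err k = (if k < 2 then 28 else C * M k)" for k
  have "err \<in> O(M)"
  proof (rule bigoI[of _ "\<bar>C\<bar>"])
    show "eventually (\<lambda>k. norm (err k) \<le> \<bar>C\<bar> * norm (M k)) at_top"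
      using eventually_ge_at_top[of 2] by eventually_elim (simp add: err_def abs_mult)
  qed
  moreover have "\<exists>c. run N \<omega> main_prog (Cell (enc_poly P) (Cell (enc_poly Q) (Num k)))
                         (enc_mat (B_prod P Q 1 (k + 1))) c \<and>
               real c \<le> 4 / 3 * M k * log 2 (real k) + err k"
    if P: "degree P = d" "d \<ge> 1" and Q: "degree Q = d - 1" and k: "k \<le> d" and n: "n \<in> N" "d < n"
      and len: "k < rem_length P Q" and deg: "\<forall>i\<in>{1..k}. mat_degree (B_mat P Q i) = 1"
    for P Q d k n
  proof -
    obtain p where p: "k \<le> 2 ^ p" "\<And>q. q < p \<Longrightarrow> 2 ^ q < k"
      using least_power_of_two by blast
    obtain e where e: "n = 2 ^ e" using N_powers_of_two n(1) by blast
    \<comment> \<open>Otherwise \<open>2 ^ e < k\<close>, although \<open>k\<close> is at most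
      \<open>d\<close> and \<open>d < n = 2 ^ e\<close>. So the padded size \<open>2 ^ p\<close>
      divides \<open>n\<close>, and its roots are available.\<close>
    have "p \<le> e" using p(2)[of e] k n(2) unfolding e by linarith
    then have pN: "2 ^ p \<in> N"
      using N_divisors[OF n(1)] unfolding e by (simp add: le_imp_power_dvd)
    have reg: "regular k (rev_pair d P Q)" "quo_mat k (rev_pair d P Q) = B_prod P Q 1 (k + 1)"
      using rem_seq_regular[OF P(1) len] deg by simp_all
    have "ev main_prog main_prog (Cell (enc_poly P) (Cell (enc_poly Q) (Num k)))
        (enc_mat (quo_mat k (rev_pair d P Q))) (cost p k + 4 * (2 ^ p + 1))"
      by (rule ev_main_prog[OF P _ pN p(1) _ reg(1)]) (use Q p(2) in auto)
    then obtain c where c: "run N \<omega> main_prog (Cell (enc_poly P) (Cell (enc_poly Q) (Num k)))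
        (enc_mat (B_prod P Q 1 (k + 1))) c" "real c \<le> cost p k + 4 * (2 ^ p + 1)"
      unfolding evs_def run_def reg(2) by blast
    have "cost p k + 4 * (2 ^ p + 1) \<le> 4 / 3 * M k * log 2 (real k) + err k"
    proof (cases "k < 2")
      case True
      then have "p = 0" using p(2)[of 0] by (cases p) auto
      then show ?thesis
        using True cost.simps(2)[of 0] by (auto simp: err_def less_2_cases_iff log_def)
    next
      case False
      then show ?thesis using C[OF _ p pN] by (simp add: err_def)
    qed
    with c show ?thesis by (blast intro: order_trans)
  qed
  ultimately show ?thesis by blast
qed

end

theorem corollary9:
  fixes N :: "nat set" and \<omega> :: "nat \<Rightarrow> 'a::field" and F M :: "nat \<Rightarrow> real"
  assumes "binary_FFT_model N \<omega> F M"
  shows "\<exists>(alg :: 'a prog) (err :: nat \<Rightarrow> real). err \<in> O(M) \<and>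
    (\<forall>(P :: 'a poly) (Q :: 'a poly) (d :: nat) (k :: nat).
      degree P = d \<and> d \<ge> 1 \<and> Q \<noteq> 0 \<and> degree Q = d - 1 \<and> k \<le> d \<and>
      (\<exists>n\<in>N. d < n) \<and>
      k < rem_length P Q \<and> (\<forall>i\<in>{1..k}. mat_degree (B_mat P Q i) = 1)
      \<longrightarrow> (\<exists>c. run N \<omega> alg (Cell (enc_poly P) (Cell (enc_poly Q) (Num k)))
                         (enc_mat (B_prod P Q 1 (k + 1))) c \<and>
               real c \<le> 4 / 3 * M k * log 2 (real k) + err k))"
  using binary_FFT_model.half_gcd_cost[OF assms] .

end
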